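(* There is an absolute constant $\alpha_0>0$ such that for every $0<\alpha\le\alpha_0$ there exist constants $C',c>0$ such that the following holds for every prime power $q$ and every $n\ge1$. Let $F_1,\dots,F_n\subset[n]=\{1,\dots,n\}$ be index sets such that $|F_i|<\alpha n$ for every $i$ and every index $i\in[n]$ is contained in at most $(1-12\alpha)n$ of the sets $F_j$. For an integer $r$ with $(1-\alpha)n\le r\le n$, let $N_{F_1,\dots,F_n}$ be the number of $n\times n$ matrices over $\mathbf{F}_q$ of rank $r$ such that, for every $i$, the entries of the $i$-th column with indices in $F_i$ are all zero. Then $$N_{F_1,\dots,F_n}=q^{n^2-\sum_i|F_i|}\Big(\mathbf{P}(Q_\infty=n-r)+O\big((C'/q)^{cn}\big)\Big),$$ where the implied constant is independent of $n,q,r$ and the sets $F_i$.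
   Context: $Q_\infty$ is the random variable on $\{0,1,2,\dots\}$ with $$\mathbf{P}(Q_\infty=k)=\frac{1}{q^{k^2}}\frac{\prod_{i=k+1}^\infty(1-1/q^i)}{\prod_{i=1}^k(1-1/q^i)}.$$ *)

theory Defs
  imports
    "HOL-Probability.Probability"
    "HOL-Number_Theory.Prime_Powers"
    "Jordan_Normal_Form.Missing_VectorSpace"
    "Jordan_Normal_Form.Matrix"
begin

section \<open>The distribution of \<open>Q\<^sub>\<infinity>\<close>\<close>

definition Q_infty_mass :: "nat \<Rightarrow> nat \<Rightarrow> real" where
  "Q_infty_mass q k =
     1 / real q ^ k\<^sup>2 * ((\<Prod>i. 1 - 1 / real q ^ (k + 1 + i)) / (\<Prod>i=1..k. 1 - 1 / real q ^ i))"

definition Q_infty :: "nat \<Rightarrow> nat pmf" where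
  "Q_infty q = embed_pmf (Q_infty_mass q)"

text \<open>
  \<^const>\<open>embed_pmf\<close> is meaningful only for a nonnegative function of total mass 1. For \<open>x = 1/q\<close>,
  the total mass is 1 by Euler's identity
  \<open>\<Sum>\<^sub>k x^(k\<^sup>2) / ((1-x)\<dots>(1-x^k))\<^sup>2 = \<Prod>\<^sub>i 1 / (1-x^i)\<close>. With \<open>P k = (1-x)\<dots>(1-x^k)\<close>,
  the sum over \<open>k\<close> of \<open>x^(k\<^sup>2+nk) / (P k * P (n+k))\<close> turns out to be independent of \<open>n\<close>,
  by telescoping, and tends to the right-hand side as \<open>n\<close> grows.
\<close>

context
  fixes x :: real
  assumes x: "0 < x" "x < 1"
begin

private definition P :: "nat \<Rightarrow> real" where "P k = (\<Prod>i=1..k. 1 - x ^ i)"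

private definition P_infty :: real where "P_infty = (\<Prod>i. 1 - x ^ (i + 1))"

private definition g :: "nat \<Rightarrow> nat \<Rightarrow> real" where
  "g n k = x ^ (k\<^sup>2 + n * k) / (P k * P (n + k))"

private lemma factor_pos: "0 < 1 - x ^ Suc i"
  using x power_Suc_less_one[of x i] by simp

private lemma P_0: "P 0 = 1"
  by (simp add: P_def)

private lemma P_Suc: "P (Suc k) = P k * (1 - x ^ Suc k)"
  by (simp add: P_def)

private lemma P_pos: "0 < P k"
  by (induction k) (use factor_pos in \<open>simp_all only: P_0 P_Suc mult_pos_pos zero_less_one\<close>)

private lemma P_altdef: "P k = (\<Prod>i<k. 1 - x ^ (i + 1))"
  by (induction k) (simp_all add: P_0 P_Suc)

private lemma convergent: "convergent_prod (\<lambda>i. 1 - x ^ (i + m + 1))"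
proof -
  have "summable (\<lambda>i. x ^ (m + 1) * x ^ i)"
    using x by (intro summable_mult summable_geometric) auto
  moreover have "norm (1 - x ^ (i + m + 1) - 1) = x ^ (m + 1) * x ^ i" for i
    using x by (simp add: power_add)
  ultimately have "summable (\<lambda>i. norm (1 - x ^ (i + m + 1) - 1))"
    by simp
  then show ?thesis
    by (intro abs_convergent_prod_imp_convergent_prod summable_imp_abs_convergent_prod)
qed

private lemma tail_tendsto: "(\<lambda>n. \<Prod>i<n. 1 - x ^ (i + m + 1)) \<longlonglongrightarrow> (\<Prod>i. 1 - x ^ (i + m + 1))"
  using convergent_prod_LIMSEQ[OF convergent[of m]] LIMSEQ_lessThan_iff_atMost[of "\<lambda>A. \<Prod>i\<in>A. 1 - x ^ (i + m + 1)"]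
  by blast

private lemma P_tendsto: "P \<longlonglongrightarrow> P_infty"
  using tail_tendsto[of 0] unfolding P_infty_def P_altdef[abs_def] by simp

private lemma P_infty_split: "P_infty = P m * (\<Prod>i. 1 - x ^ (i + m + 1))"
proof -
  have eq: "P (n + m) = P m * (\<Prod>i<n. 1 - x ^ (i + m + 1))" for n
    by (induction n) (simp_all add: P_Suc)
  have "(\<lambda>n. P (n + m)) \<longlonglongrightarrow> P m * (\<Prod>i. 1 - x ^ (i + m + 1))"
    unfolding eq by (intro tendsto_intros tail_tendsto)
  moreover have "(\<lambda>n. P (n + m)) \<longlonglongrightarrow> P_infty"
    using P_tendsto by (rule LIMSEQ_ignore_initial_segment)
  ultimately show ?thesis
    using LIMSEQ_unique by blast
qed

private lemma P_infty_pos: "0 < P_infty"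
proof -
  have "P_infty \<noteq> 0"
    unfolding P_infty_def
    using convergent[of 0] factor_pos by (intro prodinf_nonzero) (auto simp: less_le)
  moreover have "0 \<le> P_infty"
    using P_tendsto P_pos by (intro LIMSEQ_le_const) (auto intro: less_imp_le)
  ultimately show ?thesis
    by simp
qed

private lemma P_infty_le: "P_infty \<le> P k"
proof -
  have "decseq P"
    by (rule decseq_SucI) (use x P_pos in \<open>simp add: P_Suc mult_le_cancel_left1\<close>)
  then show ?thesis
    using P_tendsto by (rule decseq_ge)
qed

private lemma bound:
  assumes "d \<le> e"
  shows "x ^ e / (P a * P b) \<le> x ^ d / P_infty\<^sup>2"
proof (rule frac_le)
  show "x ^ e \<le> x ^ d"
    using x assms by (intro power_decreasing) auto
  show "P_infty\<^sup>2 \<le> P a * P b"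
    unfolding power2_eq_square
    using P_infty_le P_infty_pos by (intro mult_mono) (auto intro: less_imp_le P_pos)
qed (use x P_infty_pos in auto)

private lemma g_nonneg: "0 \<le> g n k"
  unfolding g_def using x P_pos by (intro divide_nonneg_pos mult_pos_pos) auto

private lemma summable_bound: "summable (\<lambda>k. x ^ (n + k) / P_infty\<^sup>2)"
  using x by (simp add: power_add summable_divide summable_mult summable_geometric)

private lemma g_summable: "summable (g n)"
proof (rule summable_comparison_test')
  show "summable (\<lambda>k. x ^ (0 + k) / P_infty\<^sup>2)"
    by (rule summable_bound)
  show "norm (g n k) \<le> x ^ (0 + k) / P_infty\<^sup>2" for k
  proof -
    have "0 + k \<le> k\<^sup>2 + n * k"
      by (simp add: power2_eq_square trans_le_add1)
    then show ?thesis
      using bound g_nonneg[of n k] unfolding g_def by (metis abs_of_nonneg real_norm_def)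
  qed
qed

private lemma g_step: "suminf (g (Suc n)) = suminf (g n)"
proof -
  define u where "u k = x ^ (k\<^sup>2 + n * k) * (1 - x ^ k) / (P k * P (n + k))" for k
  have diff: "g n k - g (Suc n) k = u k - u (Suc k)" for k
  proof -
    define A where "A = x ^ (k\<^sup>2 + n * k)"
    define y where "y = x ^ k"
    define z where "z = x ^ n"
    have nz: "P k \<noteq> 0" "P (n + k) \<noteq> 0" "1 - x * y \<noteq> 0" "1 - x * (z * y) \<noteq> 0"
      using P_pos[of k] P_pos[of "n + k"] factor_pos[of k] factor_pos[of "n + k"]
      by (simp_all add: y_def z_def power_add)
    have g1: "g n k = A / (P k * P (n + k))"
      by (simp add: g_def A_def)
    have g2: "g (Suc n) k = A * y / (P k * (P (n + k) * (1 - x * (z * y))))"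
      by (simp add: g_def A_def y_def z_def P_Suc power_add algebra_simps)
    have u1: "u k = A * (1 - y) / (P k * P (n + k))"
      by (simp add: u_def A_def y_def)
    have e: "(Suc k)\<^sup>2 + n * Suc k = (k\<^sup>2 + n * k) + k + k + n + 1"
      by (simp add: power2_eq_square)
    have "x ^ ((Suc k)\<^sup>2 + n * Suc k) = A * y * y * z * x"
      unfolding e by (simp add: A_def y_def z_def power_add)
    then have u2: "u (Suc k) = A * y * y * z * x * (1 - x * y) /
        (P k * (1 - x * y) * (P (n + k) * (1 - x * (z * y))))"
      by (simp add: u_def P_Suc y_def z_def power_add)
    have u2': "u (Suc k) = A * y * y * z * x / (P k * (P (n + k) * (1 - x * (z * y))))"
      unfolding u2 using nz(3) mult_divide_mult_cancel_right[of "1 - x * y"] by (simp only: mult_ac) simp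
    define d where "d = 1 - x * (z * y)"
    have "d \<noteq> 0"
      using nz by (simp add: d_def)
    have "g n k - g (Suc n) k = A * (d - y) / (P k * (P (n + k) * d))"
      unfolding g1 g2 d_def[symmetric] using nz \<open>d \<noteq> 0\<close> by (simp add: divide_simps) (simp add: algebra_simps)
    also have "d - y = (1 - y) * d - y * y * z * x"
      by (simp add: d_def algebra_simps)
    also have "A * \<dots> / (P k * (P (n + k) * d)) = u k - u (Suc k)"
      unfolding u1 u2' d_def[symmetric] using nz \<open>d \<noteq> 0\<close> by (simp add: divide_simps) (simp add: algebra_simps)
    finally show ?thesis .
  qed
  have "u \<longlonglongrightarrow> 0"
  proof (rule tendsto_sandwich[OF _ _ tendsto_const])
    have nonneg: "0 \<le> 1 - x ^ k" for k
      using x by (simp add: power_le_one)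
    then show "\<forall>\<^sub>F k in sequentially. 0 \<le> u k"
      unfolding u_def using x P_pos
      by (intro always_eventually allI divide_nonneg_pos mult_nonneg_nonneg mult_pos_pos) auto
    have "u k \<le> g n k" for k
      unfolding u_def g_def using x P_pos[of k] P_pos[of "n + k"]
      by (intro divide_right_mono mult_left_le) auto
    then show "\<forall>\<^sub>F k in sequentially. u k \<le> g n k"
      by simp
    show "g n \<longlonglongrightarrow> 0"
      using g_summable by (rule summable_LIMSEQ_zero)
  qed
  then have "(\<lambda>k. u k - u (Suc k)) sums (u 0 - 0)"
    by (rule telescope_sums')
  then have "(\<lambda>k. g n k - g (Suc n) k) sums 0"
    unfolding diff by (simp add: u_def)
  moreover have "(\<lambda>k. g n k - g (Suc n) k) sums (suminf (g n) - suminf (g (Suc n)))"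
    by (intro sums_diff summable_sums g_summable)
  ultimately show ?thesis
    using sums_unique2 by fastforce
qed

private lemma g_suminf: "suminf (g 0) = 1 / P_infty"
proof -
  have const: "suminf (g n) = suminf (g 0)" for n
    by (induction n) (simp_all add: g_step)
  define B where "B = (\<Sum>k. x ^ k) / P_infty\<^sup>2"
  have upper: "suminf (g n) - 1 / P n \<le> x ^ n * B" for n
  proof -
    have "suminf (g n) - 1 / P n = (\<Sum>k. g n (Suc k))"
      using suminf_split_head[OF g_summable[of n]] by (simp add: g_def P_0)
    also have "\<dots> \<le> (\<Sum>k. x ^ (n + k) / P_infty\<^sup>2)"
    proof (rule suminf_le)
      show "g n (Suc k) \<le> x ^ (n + k) / P_infty\<^sup>2" for k
        unfolding g_def by (rule bound) (simp add: power2_eq_square)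
      show "summable (\<lambda>k. g n (Suc k))"
        using g_summable by (simp add: summable_Suc_iff)
    qed (rule summable_bound)
    also have "\<dots> = x ^ n * B"
      using x by (simp add: B_def power_add suminf_divide suminf_mult summable_mult summable_geometric)
    finally show ?thesis .
  qed
  have lower: "0 \<le> suminf (g n) - 1 / P n" for n
  proof -
    have "0 \<le> (\<Sum>k. g n (Suc k))"
      using g_summable by (intro suminf_nonneg g_nonneg) (simp add: summable_Suc_iff)
    then show ?thesis
      using suminf_split_head[OF g_summable[of n]] by (simp add: g_def P_0)
  qed
  have "(\<lambda>n. suminf (g 0) - 1 / P n) \<longlonglongrightarrow> 0"
  proof (rule tendsto_sandwich[OF _ _ tendsto_const])
    show "\<forall>\<^sub>F n in sequentially. 0 \<le> suminf (g 0) - 1 / P n"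
      by (intro always_eventually allI) (metis lower const)
    show "\<forall>\<^sub>F n in sequentially. suminf (g 0) - 1 / P n \<le> x ^ n * B"
      by (intro always_eventually allI) (metis upper const)
    show "(\<lambda>n. x ^ n * B) \<longlonglongrightarrow> 0"
      using x by (intro tendsto_mult_left_zero LIMSEQ_power_zero) auto
  qed
  moreover have "(\<lambda>n. suminf (g 0) - 1 / P n) \<longlonglongrightarrow> suminf (g 0) - 1 / P_infty"
    using P_infty_pos by (intro tendsto_intros P_tendsto) auto
  ultimately show ?thesis
    using LIMSEQ_unique by fastforce
qed

lemma Euler_mass_sums:
  "(\<lambda>k. x ^ k\<^sup>2 * ((\<Prod>i. 1 - x ^ (i + k + 1)) / (\<Prod>i=1..k. 1 - x ^ i))) sums 1"
proof -
  have "(\<lambda>k. P_infty * g 0 k) sums (P_infty * (1 / P_infty))"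
    using g_summable[of 0] g_suminf by (intro sums_mult) (metis summable_sums)
  moreover have "P_infty * g 0 k = x ^ k\<^sup>2 * ((\<Prod>i. 1 - x ^ (i + k + 1)) / (\<Prod>i=1..k. 1 - x ^ i))" for k
    unfolding P_def[symmetric] using P_pos[of k] by (simp add: g_def P_infty_split[of k])
  ultimately show ?thesis
    using P_infty_pos by simp
qed

lemma Euler_mass_nonneg:
  "0 \<le> x ^ k\<^sup>2 * ((\<Prod>i. 1 - x ^ (i + k + 1)) / (\<Prod>i=1..k. 1 - x ^ i))"
proof -
  have "(\<Prod>i. 1 - x ^ (i + k + 1)) = P_infty / P k"
    using P_pos[of k] P_infty_split[of k] by (simp add: field_simps)
  then show ?thesis
    unfolding P_def[symmetric] using x P_pos[of k] P_infty_pos by simp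
qed

end

lemma Q_infty_mass_altdef:
  "Q_infty_mass q k =
     (1 / real q) ^ k\<^sup>2 * ((\<Prod>i. 1 - (1 / real q) ^ (i + k + 1)) / (\<Prod>i=1..k. 1 - (1 / real q) ^ i))"
  by (simp add: Q_infty_mass_def power_one_over add_ac)

lemma pmf_Q_infty:
  assumes "2 \<le> q"
  shows "pmf (Q_infty q) k = Q_infty_mass q k"
  unfolding Q_infty_def
proof (rule pmf_embed_pmf)
  have x: "0 < 1 / real q" "1 / real q < 1"
    using assms by auto
  show nonneg: "0 \<le> Q_infty_mass q j" for j
    unfolding Q_infty_mass_altdef by (rule Euler_mass_nonneg[OF x])
  have "Q_infty_mass q sums 1"
    using Euler_mass_sums[OF x] unfolding Q_infty_mass_altdef[abs_def] .
  then have "(\<Sum>j. ennreal (Q_infty_mass q j)) = 1"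
    using nonneg by (metis ennreal_1 sums_ennreal sums_unique zero_le_one)
  then show "(\<integral>\<^sup>+j. ennreal (Q_infty_mass q j) \<partial>count_space UNIV) = 1"
    by (simp add: nn_integral_count_space_nat)
qed


section \<open>Rank of matrices over a field given as a ring record\<close>

text \<open>
  The theories of Jordan Normal Form provide rank only for matrices over a type of class
  \<open>field\<close>. Constants that are uniform in the order of the field cannot be quantified outside a type,
  so the field has to be an object; carriers in \<open>nat\<close> suffice, since every finite field is
  isomorphic to one with such a carrier. Accordingly the column vectors and the
  rank are rebuilt over a record \<open>K\<close>, with span and dimension taken from the vector space
  library. The components \<open>mult\<close> and \<open>one\<close> of a module record play no role.
\<close>

definition vec_module :: "('a, 'b) ring_scheme \<Rightarrow> nat \<Rightarrow> ('a, 'a vec) module" where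
  "vec_module K n =
    \<lparr>carrier = {v \<in> carrier_vec n. \<forall>i<n. vec_index v i \<in> carrier K},
     mult = undefined,
     one = undefined,
     zero = vec n (\<lambda>i. \<zero>\<^bsub>K\<^esub>),
     add = (\<lambda>v w. vec n (\<lambda>i. vec_index v i \<oplus>\<^bsub>K\<^esub> vec_index w i)),
     smult = (\<lambda>a v. vec n (\<lambda>i. a \<otimes>\<^bsub>K\<^esub> vec_index v i))\<rparr>"

lemma vectorspace_vec_module:
  assumes "field K"
  shows "vectorspace K (vec_module K n)"
proof -
  interpret field K by fact
  have "abelian_group (vec_module K n)"
  proof (rule abelian_groupI)
    fix v assume v: "v \<in> carrier (vec_module K n)"
    show "\<exists>w\<in>carrier (vec_module K n). w \<oplus>\<^bsub>vec_module K n\<^esub> v = \<zero>\<^bsub>vec_module K n\<^esub>"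
      using v by (intro bexI[of _ "vec n (\<lambda>i. \<ominus>\<^bsub>K\<^esub> vec_index v i)"])
        (auto simp: vec_module_def l_neg)
  qed (auto simp: vec_module_def a_ac)
  then have "module K (vec_module K n)"
    by (intro module.intro module_axioms.intro)
      (auto simp: vec_module_def m_assoc l_distr r_distr is_cring)
  then show ?thesis
    by (simp add: vectorspace_def field_axioms)
qed

text \<open>Rank is the dimension of the span of the columns, for a matrix with \<open>n\<close> rows.\<close>

definition mat_rank :: "('a, 'b) ring_scheme \<Rightarrow> nat \<Rightarrow> 'a mat \<Rightarrow> nat" where
  "mat_rank K n A =
     vectorspace.dim K
       ((vec_module K n)
          \<lparr>carrier := LinearCombinations.module.span K (vec_module K n) (set (cols A))\<rparr>)"

text \<open>
  Indices run over \<open>{..<n}\<close> in place of \<open>{1..n}\<close>. The entry \<open>A $$ (k, i)\<close> is in row \<open>k\<close> and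
  column \<open>i\<close>, so \<open>F i\<close> is a set of row indices.
\<close>

definition rank_matrices_with_zeros ::
    "('a, 'b) ring_scheme \<Rightarrow> nat \<Rightarrow> nat \<Rightarrow> (nat \<Rightarrow> nat set) \<Rightarrow> 'a mat set" where
  "rank_matrices_with_zeros K n r F =
     {A \<in> carrier_mat n n. elements_mat A \<subseteq> carrier K \<and> mat_rank K n A = r \<and>
        (\<forall>i<n. \<forall>k\<in>F i. A $$ (k, i) = \<zero>\<^bsub>K\<^esub>)}"

end

theory Submission
  imports Defs
begin

text \<open>
  The columns of a uniformly random matrix with the prescribed zeros are independent, and the
  \<open>i\<close>-th is uniform on the coordinate subspace of vectors vanishing on \<open>F i\<close>. Reveal them one at a
  time and follow the dimension \<open>d\<close> of their span \<open>W\<close>. A new column uniform on a subspace \<open>U\<close> stays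
  in \<open>W\<close> with probability \<open>|W \<inter> U| / |U|\<close>, and this equals \<open>q\<^sup>d\<^sup>-\<^sup>n\<close>, the value for a
  column without constraint, as soon as \<open>W + U\<close> is the whole space. Hence the rank evolves almost
  like that of an unconstrained matrix: the final corank
  distribution differs from the unconstrained one by at most the sum over the steps of the mean
  discrepancy of the staying probability (\<open>corank_distribution_discrepancy\<close>).

  There are two bounds on the discrepancy at step \<open>i\<close>. As \<open>d \<le> i\<close>, it never exceeds
  \<open>q\<^sup>i / |U| = q powr (|F i| - (n - i))\<close>, which is small while many columns remain. On the other hand
  it vanishes unless some nonzero vector \<open>w\<close> is orthogonal to both \<open>W\<close> and \<open>U\<close>. Such a \<open>w\<close> is
  supported in \<open>F i\<close>, so there are at most \<open>q powr |F i|\<close> candidates. For a coordinate \<open>k\<close> in the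
  support of \<open>w\<close>, each of the earlier columns that is free at \<open>k\<close> is orthogonal to \<open>w\<close> with
  probability at most \<open>1/q\<close>, independently; there are at least \<open>i - (1 - 12\<alpha>) n\<close> of them
  (\<open>card_bad_tuples\<close>). With \<open>|F i| \<le> \<alpha>n\<close> the two bounds are \<open>q powr (\<alpha>n - (n - i))\<close> and
  \<open>q powr ((n - i) - 11\<alpha>n)\<close>; they cross at \<open>n - i = 6\<alpha>n\<close>, so the smaller one is always at most
  \<open>q powr (-5\<alpha>n)\<close>, and summing over \<open>n\<close> steps costs a factor \<open>n\<close>, absorbed by a part of the
  exponent.

  What remains is the unconstrained chain, whose law has a closed form
  (\<open>corank_prob_closed_form\<close>) within \<open>4 q powr (-n)\<close> of the limit law
  (\<open>corank_prob_approx_Q_infty\<close>).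
\<close>

(* Here v $ i always means an entry of a vector of variable dimension. *)
unbundle no vec_syntax

section \<open>The corank chain\<close>

text \<open>
  In the usual notation for \<open>q\<close>-shifted factorials this is \<open>(x\<^sup>m\<^sup>+\<^sup>1; x)\<^sub>N\<close>. The shift \<open>m\<close> allows
  tails of one product to be split off and estimated.
\<close>

definition qpoch :: "real \<Rightarrow> nat \<Rightarrow> nat \<Rightarrow> real" where
  "qpoch x m N = (\<Prod>i<N. 1 - x ^ (i + m + 1))"

lemma qpoch_0 [simp]: "qpoch x m 0 = 1"
  by (simp add: qpoch_def)

lemma qpoch_Suc: "qpoch x m (Suc N) = qpoch x m N * (1 - x ^ (N + m + 1))"
  by (simp add: qpoch_def)

lemma qpoch_add: "qpoch x m (M + N) = qpoch x m M * qpoch x (m + M) N"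
  by (induction N) (simp_all add: qpoch_Suc add_ac)

text \<open>
  For \<open>x = 1/q\<close>, the probability that the corank falls from \<open>s\<close> to \<open>k\<close> when \<open>m\<close> uniformly random
  vectors are added: at corank \<open>s\<close> a new vector lies in the present span with probability \<open>x\<^sup>s\<close>.
  Conditioning on the first of the \<open>m\<close> vectors, rather than the last, makes this a test function that
  can be averaged over partial matrices. The truncated \<open>0 - 1\<close> is harmless, since its weight is
  \<open>1 - x\<^sup>0 = 0\<close>.
\<close>

fun corank_prob :: "real \<Rightarrow> nat \<Rightarrow> nat \<Rightarrow> nat \<Rightarrow> real" where
  "corank_prob x k 0 s = (if s = k then 1 else 0)"
| "corank_prob x k (Suc m) s = x ^ s * corank_prob x k m s + (1 - x ^ s) * corank_prob x k m (s - 1)"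

lemma corank_prob_bounds:
  assumes "0 \<le> x" "x \<le> 1"
  shows "0 \<le> corank_prob x k m s" and "corank_prob x k m s \<le> 1"
proof -
  have "0 \<le> corank_prob x k m s \<and> corank_prob x k m s \<le> 1"
  proof (induction m arbitrary: s)
    case (Suc m)
    have xs: "0 \<le> x ^ s" "x ^ s \<le> 1"
      using assms by (simp_all add: power_le_one)
    have "corank_prob x k (Suc m) s \<le> x ^ s * 1 + (1 - x ^ s) * 1"
      using Suc xs unfolding corank_prob.simps by (intro add_mono mult_left_mono) auto
    then show ?case
      using Suc xs by simp
  qed simp
  then show "0 \<le> corank_prob x k m s" "corank_prob x k m s \<le> 1"
    by auto
qed

lemma corank_prob_eq_0_below: "s < k \<Longrightarrow> corank_prob x k m s = 0"
  by (induction m arbitrary: s) auto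

lemma corank_prob_eq_0_above: "k + m < s \<Longrightarrow> corank_prob x k m s = 0"
  by (induction m arbitrary: s) auto

text \<open>
  Of the \<open>t + l\<close> added vectors, \<open>t\<close> enlarge the span and \<open>l\<close> do not. After cancellation
  of the common factors the recurrence becomes the Pascal rule for Gaussian binomials,
  \<open>1 - x\<^sup>t\<^sup>+\<^sup>l = x\<^sup>t (1 - x\<^sup>l) + (1 - x\<^sup>t)\<close>.
\<close>

lemma corank_prob_closed_form:
  assumes x: "0 < x" "x < 1"
  shows "corank_prob x k (t + l) (k + t) =
    x ^ (k * l) * qpoch x 0 (k + t) * qpoch x 0 (t + l) / (qpoch x 0 k * qpoch x 0 t * qpoch x 0 l)"
proof -
  have nz1: "1 - x ^ (i + 1) \<noteq> 0" for i
    using x power_Suc_less_one[of x i] by simp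
  then have nz: "qpoch x 0 N \<noteq> 0" for N
    by (simp add: qpoch_def)
  show ?thesis
  proof (induction "t + l" arbitrary: t l)
    case 0
    then show ?case
      using nz by simp
  next
    case (Suc m)
    have P: "qpoch x 0 (Suc N) = qpoch x 0 N * (1 - x ^ (N + 1))" for N
      by (simp add: qpoch_Suc)
    show ?case
    proof (cases t)
      case 0
      then obtain l' where l: "l = Suc l'" "m = l'"
        using Suc(2) by (cases l) auto
      have "(1 - x ^ k) * corank_prob x k l' (k - 1) = 0"
        by (cases k) (auto simp: corank_prob_eq_0_below)
      then have "corank_prob x k (t + l) (k + t) = x ^ k * corank_prob x k (0 + l') (k + 0)"
        using 0 l by simp
      also have "\<dots> = x ^ k * x ^ (k * l')"
        using Suc(1)[of 0 l'] l nz by simp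
      finally show ?thesis
        using 0 l nz by (simp add: power_add)
    next
      case t: (Suc t')
      show ?thesis
      proof (cases l)
        case 0
        have "corank_prob x k (t + l) (k + t) = (1 - x ^ (k + t' + 1)) * corank_prob x k (t' + 0) (k + t')"
          using t 0 by (simp add: corank_prob_eq_0_above)
        also have "\<dots> = (1 - x ^ (k + t' + 1)) * (qpoch x 0 (k + t') / qpoch x 0 k)"
          using Suc(1)[of t' 0] Suc(2) t 0 nz by simp
        also have "\<dots> = qpoch x 0 (k + t) / qpoch x 0 k"
          using t by (simp add: P)
        finally show ?thesis
          using 0 nz by simp
      next
        case l: (Suc l')
        define a where "a = qpoch x 0 (k + t')"
        define b where "b = qpoch x 0 (t' + l)"
        define c where "c = qpoch x 0 k"
        define d where "d = qpoch x 0 t'"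
        define e where "e = qpoch x 0 l'"
        define y where "y = x ^ (t' + 1)"
        define z where "z = x ^ (l' + 1)"
        define w where "w = x ^ (k + t' + 1)"
        have nz': "c \<noteq> 0" "d \<noteq> 0" "e \<noteq> 0" "1 - y \<noteq> 0" "1 - z \<noteq> 0"
          using nz nz1 by (simp_all only: c_def d_def e_def y_def z_def not_False_eq_True)
        have 1: "corank_prob x k m (k + t) = x ^ (k * l') * (a * (1 - w)) * b / (c * (d * (1 - y)) * e)"
          using Suc(1)[of t l'] Suc(2) t l
          by (simp only: P a_def b_def c_def d_def e_def y_def w_def add_Suc_right add_Suc) simp
        have 2: "corank_prob x k m (k + t') = x ^ (k * l') * x ^ k * a * b / (c * d * (e * (1 - z)))"
          using Suc(1)[of t' l] Suc(2) t l
          by (simp add: P a_def b_def c_def d_def e_def z_def power_add mult_ac)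
        have w: "w = x ^ k * y"
          by (simp add: w_def y_def power_add mult_ac)
        have "corank_prob x k (t + l) (k + t) =
            w * corank_prob x k m (k + t) + (1 - w) * corank_prob x k m (k + t')"
          using Suc(2)[symmetric] t by (simp add: w_def)
        also have "\<dots> = x ^ (k * l') * x ^ k * (a * (1 - w)) * (b * (1 - y * z)) /
            (c * (d * (1 - y)) * (e * (1 - z)))"
          unfolding 1 2 using nz' by (simp add: w divide_simps) (simp add: algebra_simps)
        also have "y * z = x ^ (t' + l + 1)"
          using l by (simp add: y_def z_def power_add mult_ac)
        finally show ?thesis
          using t l
          by (simp add: P a_def b_def c_def d_def e_def y_def z_def w_def power_add mult_ac)
      qed
    qed
  qed
qed

section \<open>Comparison with the limiting law\<close>

lemma qpoch_bounds:
  assumes x: "0 < x" "x \<le> 1 / 2"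
  shows "1 - 2 * x ^ (m + 1) \<le> qpoch x m N" and "qpoch x m N \<le> 1" and "0 < qpoch x m N"
proof -
  have a: "0 \<le> x ^ (i + m + 1)" "x ^ (i + m + 1) \<le> 1" for i
    using x power_le_one[of x "i + m + 1"] by simp_all
  have "(\<Sum>i<N. x ^ (i + m + 1)) = x ^ (m + 1) * (\<Sum>i<N. x ^ i)"
    by (simp add: sum_distrib_left power_add mult_ac)
  also have "\<dots> \<le> x ^ (m + 1) * 2"
  proof (rule mult_left_mono)
    have "(\<Sum>i<N. x ^ i) \<le> (\<Sum>i<N. (1 / 2) ^ i)"
      using x by (intro sum_mono power_mono) auto
    also have "\<dots> \<le> 2"
      by (subst sum_gp_strict) simp
    finally show "(\<Sum>i<N. x ^ i) \<le> 2" .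
  qed (use x in simp)
  finally have "1 - 2 * x ^ (m + 1) \<le> 1 - (\<Sum>i<N. x ^ (i + m + 1))"
    by simp
  also have "\<dots> \<le> qpoch x m N"
    unfolding qpoch_def using a by (intro Weierstrass_prod_ineq) auto
  finally show "1 - 2 * x ^ (m + 1) \<le> qpoch x m N" .
  show "qpoch x m N \<le> 1"
    unfolding qpoch_def using a by (intro prod_le_1) auto
  show "0 < qpoch x m N"
    unfolding qpoch_def
  proof (rule prod_pos)
    show "0 < 1 - x ^ (i + m + 1)" if "i \<in> {..<N}" for i
      using x power_Suc_less_one[of x "i + m"] by simp
  qed
qed

text \<open>
  The estimate of \<open>qpoch_bounds\<close> is void at \<open>m = 0\<close>, \<open>x = 1/2\<close>. Treating the first factor
  separately leaves a product starting at \<open>x\<^sup>2\<close>, for which it gives \<open>1/2\<close>.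
\<close>

lemma qpoch_0_ge_quarter:
  assumes x: "0 < x" "x \<le> 1 / 2"
  shows "1 / 4 \<le> qpoch x 0 N"
proof (cases N)
  case (Suc M)
  have "qpoch x 0 (1 + M) = (1 - x) * qpoch x 1 M"
    unfolding qpoch_add by (simp add: qpoch_def)
  moreover have "1 / 2 * (1 / 2) \<le> (1 - x) * qpoch x 1 M"
  proof (rule mult_mono)
    have "x\<^sup>2 \<le> (1 / 2)\<^sup>2"
      using x by (intro power_mono) auto
    then show "1 / 2 \<le> qpoch x 1 M"
      using qpoch_bounds(1)[OF x, of 1 M] by (simp add: power2_eq_square)
  qed (use x in auto)
  ultimately show ?thesis
    using Suc by simp
qed simp

lemma qpoch_tendsto:
  assumes x: "0 < x" "x \<le> 1 / 2"
  shows "qpoch x m \<longlonglongrightarrow> (\<Prod>i. 1 - x ^ (i + m + 1))"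
proof -
  have "summable (\<lambda>i. x ^ (m + 1) * x ^ i)"
    using x by (intro summable_mult summable_geometric) auto
  moreover have "norm (1 - x ^ (i + m + 1) - 1) = x ^ (m + 1) * x ^ i" for i
    using x by (simp add: power_add)
  ultimately have "summable (\<lambda>i. norm (1 - x ^ (i + m + 1) - 1))"
    by simp
  then have "convergent_prod (\<lambda>i. 1 - x ^ (i + m + 1))"
    by (intro abs_convergent_prod_imp_convergent_prod summable_imp_abs_convergent_prod)
  from convergent_prod_LIMSEQ[OF this] show ?thesis
    unfolding qpoch_def[abs_def]
    using LIMSEQ_lessThan_iff_atMost[of "\<lambda>A. \<Prod>i\<in>A. 1 - x ^ (i + m + 1)"] by blast
qed

lemma qpoch_infinite_split:
  assumes x: "0 < x" "x \<le> 1 / 2"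
  shows "(\<Prod>i. 1 - x ^ (i + m + 1)) = qpoch x m N * (\<Prod>i. 1 - x ^ (i + (m + N) + 1))"
proof (rule LIMSEQ_unique)
  show "(\<lambda>M. qpoch x m (M + N)) \<longlonglongrightarrow> (\<Prod>i. 1 - x ^ (i + m + 1))"
    using qpoch_tendsto[OF x] by (rule LIMSEQ_ignore_initial_segment)
  have "(\<lambda>M. qpoch x m (N + M)) \<longlonglongrightarrow> qpoch x m N * (\<Prod>i. 1 - x ^ (i + (m + N) + 1))"
    unfolding qpoch_add by (intro tendsto_intros qpoch_tendsto[OF x])
  then show "(\<lambda>M. qpoch x m (M + N)) \<longlonglongrightarrow> qpoch x m N * (\<Prod>i. 1 - x ^ (i + (m + N) + 1))"
    by (simp add: add.commute)
qed

text \<open>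
  With \<open>x = 1/q\<close>, both sides contain the factor
  \<open>x powr (k\<^sup>2) (1-x\<^sup>k\<^sup>+\<^sup>1)\<dots>(1-x\<^sup>n) / ((1-x)\<dots>(1-x\<^sup>k))\<close>. The cofactors are
  \<open>(1-x\<^sup>n\<^sup>-\<^sup>k\<^sup>+\<^sup>1)\<dots>(1-x\<^sup>n)\<close> and the infinite product from \<open>1-x\<^sup>n\<^sup>+\<^sup>1\<close> on, both within
  \<open>x\<^sup>n\<^sup>-\<^sup>k\<close> of 1. As \<open>k \<le> k\<^sup>2\<close>, the common factor makes up for the loss of \<open>k\<close> in this exponent.
\<close>

lemma corank_prob_approx_Q_infty:
  assumes q: "2 \<le> q" and k: "k \<le> n"
  shows "\<bar>corank_prob (1 / real q) k n n - pmf (Q_infty q) k\<bar> \<le> 4 * (1 / real q) ^ n"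
proof -
  define x where "x = 1 / real q"
  have x: "0 < x" "x \<le> 1 / 2"
    using q by (auto simp: x_def field_simps)
  define R where "R = (\<Prod>i. 1 - x ^ (i + (k + (n - k)) + 1))"
  define S where "S = qpoch x (n - k) k"
  define p where "p = x ^ k\<^sup>2 * (qpoch x k (n - k) / qpoch x 0 k)"
  have mass: "pmf (Q_infty q) k = p * R"
  proof -
    have "(\<Prod>i=1..k. 1 - x ^ i) = qpoch x 0 k"
      unfolding qpoch_def by (rule prod.reindex_bij_witness[of _ Suc "\<lambda>i. i - 1"]) auto
    then show ?thesis
      unfolding pmf_Q_infty[OF q] Q_infty_mass_altdef x_def[symmetric]
        qpoch_infinite_split[OF x, of k "n - k"] p_def R_def by simp
  qed
  have prob: "corank_prob x k n n = p * S"
  proof -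
    have pos: "0 < qpoch x 0 N" for N
      using qpoch_bounds(3)[OF x] .
    have "corank_prob x k ((n - k) + k) (k + (n - k)) =
        x ^ (k * k) * qpoch x 0 (k + (n - k)) * qpoch x 0 ((n - k) + k) /
          (qpoch x 0 k * qpoch x 0 (n - k) * qpoch x 0 k)"
      by (rule corank_prob_closed_form) (use x in auto)
    also have "\<dots> = p * S"
      unfolding qpoch_add p_def S_def using pos[of k] pos[of "n - k"]
      by (simp add: power2_eq_square)
    finally show ?thesis
      using k by simp
  qed
  have p: "0 \<le> p" "p \<le> x ^ k\<^sup>2 * 4"
  proof -
    show "0 \<le> p"
      unfolding p_def using qpoch_bounds(3)[OF x] x by (intro mult_nonneg_nonneg divide_nonneg_pos) (auto intro: less_imp_le)
    have "qpoch x k (n - k) / qpoch x 0 k \<le> 1 / (1 / 4)"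
      using qpoch_bounds[OF x] qpoch_0_ge_quarter[OF x] by (intro frac_le) auto
    then show "p \<le> x ^ k\<^sup>2 * 4"
      unfolding p_def using x by (intro mult_left_mono) auto
  qed
  have "2 * x ^ (n - k + 1) \<le> x ^ (n - k)"
    using x mult_right_mono[of "2 * x" 1 "x ^ (n - k)"] by simp
  then have S: "1 - x ^ (n - k) \<le> S" "S \<le> 1"
    using qpoch_bounds(1,2)[OF x, of "n - k" k] unfolding S_def by linarith+
  have "2 * x ^ (n + 1) \<le> x ^ n"
    using x mult_right_mono[of "2 * x" 1 "x ^ n"] by simp
  moreover have "x ^ n \<le> x ^ (n - k)"
    using x by (intro power_decreasing) auto
  ultimately have n: "1 - x ^ (n - k) \<le> 1 - 2 * x ^ (n + 1)"
    by linarith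
  have lim: "qpoch x n \<longlonglongrightarrow> R"
    using qpoch_tendsto[OF x, of n] k by (simp add: R_def)
  have R: "1 - x ^ (n - k) \<le> R" "R \<le> 1"
    using LIMSEQ_le_const[OF lim, of "1 - x ^ (n - k)"] LIMSEQ_le_const2[OF lim, of 1]
      qpoch_bounds(1,2)[OF x, of n] n order_trans by blast+
  have "\<bar>p * S - p * R\<bar> = p * \<bar>S - R\<bar>"
    using p by (simp add: abs_mult right_diff_distrib[symmetric])
  also have "\<dots> \<le> (x ^ k\<^sup>2 * 4) * x ^ (n - k)"
    using p S R x by (intro mult_mono) auto
  also have "\<dots> = 4 * x ^ (k\<^sup>2 + (n - k))"
    by (simp add: power_add)
  also have "\<dots> \<le> 4 * x ^ n"
  proof -
    have "k \<le> k\<^sup>2"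
      by (simp add: power2_eq_square)
    then show ?thesis
      using x k by (intro mult_left_mono power_decreasing) auto
  qed
  finally show ?thesis
    unfolding prob[folded x_def] mass x_def[symmetric] .
qed

section \<open>Vector spaces over a finite field\<close>

context vectorspace
begin

lemma vectorspace_md:
  assumes "submodule K W V"
  shows "vectorspace K (md W)"
  by (rule subspace_is_vs) (use assms vectorspace_axioms in \<open>simp add: subspace_def\<close>)

lemma submodule_minus:
  assumes "submodule K W V" "v \<in> W" "w \<in> W"
  shows "v \<ominus>\<^bsub>V\<^esub> w \<in> W"
proof -
  interpret W: submodule K W V by fact
  have w: "w \<in> carrier V"
    using assms(3) W.subset by auto
  have "\<ominus>\<^bsub>K\<^esub> \<one>\<^bsub>K\<^esub> \<odot>\<^bsub>V\<^esub> w \<in> W"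
    using assms by (intro W.smult_closed) auto
  then show ?thesis
    using assms(2) smult_minus_1_back[OF w] by (simp add: a_minus_def W.m_closed)
qed

lemma span_insert_eq:
  assumes "S \<subseteq> carrier V" "v \<in> span S"
  shows "span (insert v S) = span S"
  using already_in_span[OF assms] by simp

end

locale finite_vectorspace = vectorspace +
  assumes finite_scalars: "finite (carrier K)"
    and finite_vectors: "finite (carrier V)"
begin

abbreviation q :: nat where "q \<equiv> card (carrier K)"

abbreviation rank :: "'c set \<Rightarrow> nat" where
  "rank S \<equiv> vectorspace.dim K (md (span S))"

lemma q_ge_2: "2 \<le> q"
proof -
  have "card {\<zero>\<^bsub>K\<^esub>, \<one>\<^bsub>K\<^esub>} \<le> q"
    using finite_scalars by (intro card_mono) auto
  then show ?thesis
    by simp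
qed

lemma card_eq_power_card_basis:
  assumes "basis B"
  shows "card (carrier V) = q ^ card B"
proof -
  have BV: "B \<subseteq> carrier V" and fin: "finite B"
    using assms finite_vectors finite_subset by (auto simp: basis_def)
  have "bij_betw (\<lambda>a. lincomb a B) (B \<rightarrow>\<^sub>E carrier K) (carrier V)"
    unfolding bij_betw_def
  proof (intro conjI inj_onI subset_antisym subsetI)
    fix a b assume ab: "a \<in> B \<rightarrow>\<^sub>E carrier K" "b \<in> B \<rightarrow>\<^sub>E carrier K" "lincomb a B = lincomb b B"
    have "lincomb a B \<in> carrier V"
      using ab BV by (intro lincomb_closed) auto
    then show "a = b"
      using assms ab unfolding basis_criterion[OF fin BV] by metis
  next
    fix v assume "v \<in> carrier V"
    then show "v \<in> (\<lambda>a. lincomb a B) ` (B \<rightarrow>\<^sub>E carrier K)"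
      using assms unfolding basis_criterion[OF fin BV] by blast
  qed (use BV in auto)
  then have "card (B \<rightarrow>\<^sub>E carrier K) = card (carrier V)"
    by (rule bij_betw_same_card)
  then show ?thesis
    using fin by (simp add: card_PiE)
qed

lemma exists_basis: "\<exists>B. finite B \<and> basis B"
proof (rule finite_basis_exists)
  have "span (carrier V) = carrier V"
    using in_own_span[of "carrier V"] span_is_subset2[of "carrier V"] by auto
  then show fin_dim
    unfolding fin_dim_def using finite_vectors by blast
qed

lemma card_eq_power_dim: "card (carrier V) = q ^ dim"
  using exists_basis card_eq_power_card_basis dim_basis by metis

lemma finite_vectorspace_md:
  assumes "submodule K W V"
  shows "finite_vectorspace K (md W)"
proof -
  interpret W: submodule K W V by fact
  have "finite W"
    using W.subset finite_vectors finite_subset by blast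
  then show ?thesis
    using vectorspace_md[OF assms] finite_scalars
    by (simp add: finite_vectorspace_def finite_vectorspace_axioms_def)
qed

lemma card_span:
  assumes "S \<subseteq> carrier V"
  shows "card (span S) = q ^ rank S"
  using finite_vectorspace.card_eq_power_dim[OF finite_vectorspace_md[OF span_is_submodule[OF assms]]]
  by simp

lemma rank_unique:
  assumes "S \<subseteq> carrier V" "card (span S) = q ^ d"
  shows "rank S = d"
  using card_span[OF assms(1)] assms(2) q_ge_2 by (simp add: power_inject_exp)

lemma submodule_basis:
  assumes "submodule K W V"
  obtains B where "finite B" "B \<subseteq> carrier V" "lin_indpt B" "span B = W" "card W = q ^ card B"
proof -
  interpret W: finite_vectorspace K "md W"
    by (rule finite_vectorspace_md) fact
  obtain B where B: "finite B" "W.basis B"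
    using W.exists_basis by blast
  have BW: "B \<subseteq> W"
    using B by (simp add: W.basis_def)
  have "W \<subseteq> carrier V"
    using assms by (simp add: submodule_def)
  show ?thesis
  proof
    show "lin_indpt B" "span B = W"
      using B(2) span_li_not_depend[OF BW assms] by (simp_all add: W.basis_def)
    show "card W = q ^ card B"
      using W.card_eq_power_card_basis[OF B(2)] by simp
  qed (use B BW \<open>W \<subseteq> carrier V\<close> in auto)
qed

lemma rank_insert:
  assumes S: "S \<subseteq> carrier V" and v: "v \<in> carrier V"
  shows "rank (insert v S) = (if v \<in> span S then rank S else Suc (rank S))"
proof (cases "v \<in> span S")
  case True
  then show ?thesis
    by (simp add: span_insert_eq[OF S])
next
  case False
  obtain B where B: "finite B" "B \<subseteq> carrier V" "lin_indpt B" "span B = span S"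
      "card (span S) = q ^ card B"
    using submodule_basis[OF span_is_submodule[OF S]] by metis
  have vB: "v \<notin> B"
    using False B in_own_span[OF B(2)] by auto
  then have li: "lin_indpt (insert v B)"
    using lin_dep_iff_in_span[OF B(2,3) v vB] False B(4) by simp
  have span: "span (insert v B) = span (insert v S)"
    using span_union1[of B S "{v}" "{v}"] span_union1[of S B "{v}" "{v}"] S B v by auto
  have sub: "submodule K (span (insert v S)) V"
    using S v by (intro span_is_submodule) auto
  interpret W: finite_vectorspace K "md (span (insert v S))"
    by (rule finite_vectorspace_md[OF sub])
  have BW: "insert v B \<subseteq> span (insert v S)"
    using in_own_span[of "insert v B"] B v unfolding span by auto
  have "W.basis (insert v B)"
    unfolding W.basis_def using li span BW span_li_not_depend[OF BW sub] by simp
  then have "rank (insert v S) = card (insert v B)"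
    using B(1) by (intro W.dim_basis) auto
  also have "\<dots> = Suc (rank S)"
    using B vB rank_unique[OF S B(5)] by simp
  finally show ?thesis
    using False by simp
qed

lemma rank_empty: "rank {} = 0"
  by (rule rank_unique) (simp_all add: span_empty)

lemma rank_le_length:
  assumes "set xs \<subseteq> carrier V"
  shows "rank (set xs) \<le> length xs"
  using assms by (induction xs) (auto simp: rank_empty rank_insert)

lemma rank_le_dim:
  assumes "S \<subseteq> carrier V"
  shows "rank S \<le> dim"
proof -
  have "q ^ rank S \<le> q ^ dim"
    unfolding card_span[OF assms, symmetric] card_eq_power_dim[symmetric]
    using assms by (intro card_mono finite_vectors span_is_subset2)
  then show ?thesis
    using q_ge_2 by (simp add: power_le_imp_le_exp)
qed

text \<open>
  The dimension formula for \<open>U + W = V\<close>, in counting form: addition maps \<open>U \<times> W\<close> onto \<open>V\<close>, and every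
  fibre is a translate of \<open>{(z, -z) | z \<in> U \<inter> W}\<close>.
\<close>

lemma card_Int_of_sum_eq_carrier:
  assumes U: "submodule K U V" and W: "submodule K W V"
    and sum: "submodule_sum U W = carrier V"
  shows "card (U \<inter> W) * card (carrier V) = card U * card W"
proof -
  interpret U: submodule K U V by fact
  interpret W: submodule K W V by fact
  define fibre where "fibre g = {p \<in> U \<times> W. fst p \<oplus>\<^bsub>V\<^esub> snd p = g}" for g
  have finU: "finite U" and finW: "finite W"
    using U.subset W.subset finite_vectors finite_subset by blast+
  have cancel1: "x \<oplus>\<^bsub>V\<^esub> (y \<oplus>\<^bsub>V\<^esub> \<ominus>\<^bsub>V\<^esub> x) = y"
    if "x \<in> carrier V" "y \<in> carrier V" for x y
    using that by (metis M.a_comm M.r_neg2 M.a_inv_closed)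
  have cancel2: "x \<oplus>\<^bsub>V\<^esub> (y \<oplus>\<^bsub>V\<^esub> (z \<oplus>\<^bsub>V\<^esub> \<ominus>\<^bsub>V\<^esub> x)) = y \<oplus>\<^bsub>V\<^esub> z"
    if "x \<in> carrier V" "y \<in> carrier V" "z \<in> carrier V" for x y z
    using that by (metis M.a_assoc M.a_closed M.a_inv_closed cancel1)
  note cancel = cancel1 cancel2
  have card_fibre: "card (fibre g) = card (U \<inter> W)" if g: "g \<in> carrier V" for g
  proof -
    obtain u w where uw: "u \<in> U" "w \<in> W" "g = u \<oplus>\<^bsub>V\<^esub> w"
      using g unfolding sum[symmetric] submodule_sum_def by auto
    have uwV: "u \<in> carrier V" "w \<in> carrier V"
      using uw U.subset W.subset by auto
    have "bij_betw (\<lambda>z. (u \<oplus>\<^bsub>V\<^esub> z, w \<ominus>\<^bsub>V\<^esub> z)) (U \<inter> W) (fibre g)"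
    proof (rule bij_betwI[where g = "\<lambda>p. fst p \<ominus>\<^bsub>V\<^esub> u"])
      show "(\<lambda>z. (u \<oplus>\<^bsub>V\<^esub> z, w \<ominus>\<^bsub>V\<^esub> z)) \<in> (U \<inter> W) \<rightarrow> fibre g"
      proof
        fix z assume z: "z \<in> U \<inter> W"
        then have zV: "z \<in> carrier V"
          using U.subset by auto
        have "(u \<oplus>\<^bsub>V\<^esub> z) \<oplus>\<^bsub>V\<^esub> (w \<ominus>\<^bsub>V\<^esub> z) = g"
          using uwV zV by (simp add: uw(3) a_minus_def M.a_ac M.r_neg M.r_neg2 M.r_neg1 cancel)
        then show "(u \<oplus>\<^bsub>V\<^esub> z, w \<ominus>\<^bsub>V\<^esub> z) \<in> fibre g"
          using z uw submodule_minus[OF W] by (auto simp: fibre_def)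
      qed
      show "(\<lambda>p. fst p \<ominus>\<^bsub>V\<^esub> u) \<in> fibre g \<rightarrow> U \<inter> W"
      proof
        fix p assume p: "p \<in> fibre g"
        obtain a b where ab: "p = (a, b)" "a \<in> U" "b \<in> W" "a \<oplus>\<^bsub>V\<^esub> b = u \<oplus>\<^bsub>V\<^esub> w"
          using p uw(3) by (cases p) (auto simp: fibre_def)
        have abV: "a \<in> carrier V" "b \<in> carrier V"
          using ab U.subset W.subset by auto
        have "a \<ominus>\<^bsub>V\<^esub> u = w \<ominus>\<^bsub>V\<^esub> b"
        proof -
          have "a \<ominus>\<^bsub>V\<^esub> u = (a \<oplus>\<^bsub>V\<^esub> b) \<oplus>\<^bsub>V\<^esub> (\<ominus>\<^bsub>V\<^esub> b \<oplus>\<^bsub>V\<^esub> \<ominus>\<^bsub>V\<^esub> u)"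
            using abV uwV by (simp add: a_minus_def M.a_ac M.r_neg M.r_neg2 M.r_neg1 cancel)
          also have "\<dots> = w \<ominus>\<^bsub>V\<^esub> b"
            unfolding ab(4) using abV uwV by (simp add: a_minus_def M.a_ac M.r_neg M.r_neg2 M.r_neg1 cancel)
          finally show ?thesis .
        qed
        moreover have "a \<ominus>\<^bsub>V\<^esub> u \<in> U" "w \<ominus>\<^bsub>V\<^esub> b \<in> W"
          using submodule_minus[OF U] submodule_minus[OF W] ab uw by blast+
        ultimately show "fst p \<ominus>\<^bsub>V\<^esub> u \<in> U \<inter> W"
          by (simp add: ab(1))
      qed
      show "fst (u \<oplus>\<^bsub>V\<^esub> z, w \<ominus>\<^bsub>V\<^esub> z) \<ominus>\<^bsub>V\<^esub> u = z" if "z \<in> U \<inter> W" for z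
      proof -
        have "z \<in> carrier V"
          using that U.subset by auto
        then show ?thesis
          using uwV by (simp add: a_minus_def M.a_ac M.r_neg M.r_neg2 M.r_neg1 cancel)
      qed
      show "(u \<oplus>\<^bsub>V\<^esub> (fst p \<ominus>\<^bsub>V\<^esub> u), w \<ominus>\<^bsub>V\<^esub> (fst p \<ominus>\<^bsub>V\<^esub> u)) = p" if p: "p \<in> fibre g" for p
      proof -
        obtain a b where ab: "p = (a, b)" "a \<in> U" "b \<in> W" "a \<oplus>\<^bsub>V\<^esub> b = u \<oplus>\<^bsub>V\<^esub> w"
          using p uw(3) by (cases p) (auto simp: fibre_def)
        have abV: "a \<in> carrier V" "b \<in> carrier V"
          using ab U.subset W.subset by auto
        have "u \<oplus>\<^bsub>V\<^esub> (a \<ominus>\<^bsub>V\<^esub> u) = a"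
          using abV uwV by (simp add: a_minus_def M.a_ac M.r_neg M.r_neg2 M.r_neg1 cancel)
        moreover have "w \<ominus>\<^bsub>V\<^esub> (a \<ominus>\<^bsub>V\<^esub> u) = (u \<oplus>\<^bsub>V\<^esub> w) \<oplus>\<^bsub>V\<^esub> \<ominus>\<^bsub>V\<^esub> a"
          using abV uwV by (simp add: a_minus_def M.minus_add M.a_ac M.r_neg M.r_neg2 M.r_neg1 cancel)
        moreover have "(a \<oplus>\<^bsub>V\<^esub> b) \<oplus>\<^bsub>V\<^esub> \<ominus>\<^bsub>V\<^esub> a = b"
          using abV by (simp add: M.a_ac M.r_neg M.r_neg2 M.r_neg1 cancel)
        ultimately show ?thesis
          by (simp add: ab(1) ab(4))
      qed
    qed
    then show ?thesis
      by (metis bij_betw_same_card)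
  qed
  have "U \<times> W = (\<Union>g\<in>carrier V. fibre g)"
    using U.subset W.subset by (auto simp: fibre_def subset_iff)
  then have "card U * card W = card (\<Union>g\<in>carrier V. fibre g)"
    by (metis card_cartesian_product)
  also have "\<dots> = (\<Sum>g\<in>carrier V. card (fibre g))"
    by (rule card_UN_disjoint) (use finite_vectors finU finW in \<open>auto simp: fibre_def\<close>)
  also have "\<dots> = card (U \<inter> W) * card (carrier V)"
    by (simp add: card_fibre)
  finally show ?thesis
    by simp
qed

end

section \<open>Exposing the columns one at a time\<close>

definition tuples :: "(nat \<Rightarrow> 'c set) \<Rightarrow> nat \<Rightarrow> 'c list set" where
  "tuples A i = {xs. length xs = i \<and> (\<forall>j<i. xs ! j \<in> A j)}"

lemma tuples_0: "tuples A 0 = {[]}"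
  by (auto simp: tuples_def)

lemma tuples_Suc: "tuples A (Suc i) = (\<lambda>(xs, v). xs @ [v]) ` (tuples A i \<times> A i)"
proof (intro subset_antisym subsetI)
  fix ys assume ys: "ys \<in> tuples A (Suc i)"
  then obtain xs v where ys_eq: "ys = xs @ [v]"
    by (cases ys rule: rev_cases) (auto simp: tuples_def)
  have "xs ! j \<in> A j" if "j < i" for j
    using ys that by (auto simp: tuples_def ys_eq nth_append dest: spec[of _ j])
  moreover have "v \<in> A i"
    using ys by (auto simp: tuples_def ys_eq nth_append dest: spec[of _ i])
  ultimately show "ys \<in> (\<lambda>(xs, v). xs @ [v]) ` (tuples A i \<times> A i)"
    using ys by (auto simp: tuples_def ys_eq)
qed (auto simp: tuples_def nth_append less_Suc_eq)

lemma sum_tuples_Suc: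
  "(\<Sum>ys\<in>tuples A (Suc i). g ys) = (\<Sum>xs\<in>tuples A i. \<Sum>v\<in>A i. g (xs @ [v]))"
proof -
  have "inj_on (\<lambda>(xs, v). xs @ [v]) (tuples A i \<times> A i)"
    by (auto simp: inj_on_def)
  then have "(\<Sum>ys\<in>tuples A (Suc i). g ys) = (\<Sum>p\<in>tuples A i \<times> A i. g (fst p @ [snd p]))"
    unfolding tuples_Suc by (subst sum.reindex) (auto simp: case_prod_beta)
  then show ?thesis
    by (simp add: sum.cartesian_product case_prod_beta)
qed

lemma finite_tuples: "(\<And>j. finite (A j)) \<Longrightarrow> finite (tuples A i)"
  by (induction i) (simp_all add: tuples_0 tuples_Suc)

lemma card_tuples:
  "card (tuples A i) = (\<Prod>j<i. card (A j))"
proof (induction i)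
  case (Suc i)
  have "card (tuples A (Suc i)) = (\<Sum>ys\<in>tuples A (Suc i). 1)"
    by simp
  also have "\<dots> = card (tuples A i) * card (A i)"
    by (subst sum_tuples_Suc) simp
  finally show ?case
    using Suc by simp
qed (simp add: tuples_0)

lemma set_tuples: "(\<And>j. A j \<subseteq> C) \<Longrightarrow> xs \<in> tuples A i \<Longrightarrow> set xs \<subseteq> C"
  by (fastforce simp: tuples_def in_set_conv_nth)

context finite_vectorspace
begin

abbreviation stay_prob :: "'c set \<Rightarrow> 'c list \<Rightarrow> real" where
  "stay_prob U xs \<equiv> real (card (span (set xs) \<inter> U)) / real (card U)"

text \<open>
  How far the conditional probability that a column uniform on \<open>U\<close> leaves the span of \<open>xs\<close> unchanged
  is from its value for a column uniform on the whole space.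
\<close>

definition discrepancy :: "'c set \<Rightarrow> 'c list \<Rightarrow> real" where
  "discrepancy U xs = \<bar>stay_prob U xs - (1 / real q) ^ (dim - rank (set xs))\<bar>"

context
  fixes A :: "nat \<Rightarrow> 'c set"
  assumes A: "\<And>j. submodule K (A j) V"
begin

lemma constraint_subset: "A j \<subseteq> carrier V"
  using A by (simp add: submodule_def)

lemma finite_constraint: "finite (A j)"
  using constraint_subset finite_vectors finite_subset by blast

lemma card_constraint_pos: "0 < card (A j)"
proof -
  have "\<zero>\<^bsub>V\<^esub> \<in> A j"
    using A by (simp add: submodule_def)
  then show ?thesis
    using finite_constraint card_gt_0_iff by blast
qed

lemma card_tuples_pos: "0 < card (tuples A i)"
  using card_constraint_pos by (simp add: card_tuples prod_pos)

lemma set_tuples_subset: "xs \<in> tuples A i \<Longrightarrow> set xs \<subseteq> carrier V"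
  using set_tuples[of A "carrier V"] constraint_subset by blast

text \<open>
  Given \<open>xs\<close>, replacing a constrained column by an unconstrained one changes the expected value of the
  test function only through the probability of the two possible new ranks; as the
  test function takes values in \<open>[0, 1]\<close>, the change is at most the change of that probability.
\<close>

lemma exposure_step:
  fixes k m :: nat
  assumes xs: "xs \<in> tuples A i"
  defines "h \<equiv> corank_prob (1 / real q) k"
  shows "\<bar>(\<Sum>v\<in>A i. h m (dim - rank (set (xs @ [v])))) / card (A i) - h (Suc m) (dim - rank (set xs))\<bar>
    \<le> discrepancy (A i) xs"
proof -
  define W where "W = span (set xs)"
  define d where "d = rank (set xs)"
  define \<phi> where "\<phi> = stay_prob (A i) xs"
  define y where "y = (1 / real q) ^ (dim - d)"
  have xsV: "set xs \<subseteq> carrier V"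
    using xs by (rule set_tuples_subset)
  have "(\<Sum>v\<in>A i. h m (dim - rank (set (xs @ [v])))) =
      (\<Sum>v\<in>A i. if v \<in> W then h m (dim - d) else h m (dim - Suc d))"
    using xsV constraint_subset[of i]
    by (intro sum.cong) (auto simp: rank_insert W_def d_def)
  also have "\<dots> = real (card (A i \<inter> W)) * h m (dim - d) + real (card (A i - W)) * h m (dim - Suc d)"
    using finite_constraint[of i] by (simp add: sum.If_cases Collect_conj_eq[symmetric] Diff_eq Int_def)
  also have "card (A i - W) = card (A i) - card (W \<inter> A i)"
    using finite_constraint[of i] by (metis Int_commute card_Diff_subset_Int finite_Int)
  also have "real \<dots> = real (card (A i)) - real (card (W \<inter> A i))"
    using finite_constraint[of i] by (intro of_nat_diff card_mono) auto
  finally have split: "(\<Sum>v\<in>A i. h m (dim - rank (set (xs @ [v])))) / card (A i) =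
      \<phi> * h m (dim - d) + (1 - \<phi>) * h m (dim - Suc d)"
    using card_constraint_pos[of i] by (simp add: \<phi>_def W_def field_simps Int_commute)
  have chain: "h (Suc m) (dim - rank (set xs)) = y * h m (dim - d) + (1 - y) * h m (dim - Suc d)"
    by (simp add: h_def y_def d_def)
  have "\<bar>(\<Sum>v\<in>A i. h m (dim - rank (set (xs @ [v])))) / card (A i) - h (Suc m) (dim - rank (set xs))\<bar> =
      \<bar>(\<phi> - y) * (h m (dim - d) - h m (dim - Suc d))\<bar>"
    unfolding split chain by (simp add: algebra_simps)
  also have "\<dots> \<le> \<bar>\<phi> - y\<bar> * 1"
  proof -
    have bounds: "0 \<le> h m s" "h m s \<le> 1" for s
      unfolding h_def using q_ge_2 by (auto intro!: corank_prob_bounds)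
    have "\<bar>h m (dim - d) - h m (dim - Suc d)\<bar> \<le> 1"
      using bounds[of "dim - d"] bounds[of "dim - Suc d"] by linarith
    then show ?thesis
      unfolding abs_mult by (intro mult_left_mono) auto
  qed
  finally show ?thesis
    by (simp add: discrepancy_def \<phi>_def y_def d_def)
qed

text \<open>
  A hybrid argument: \<open>G i\<close> below is the probability of final corank \<open>k\<close> when the first \<open>i\<close> columns are
  constrained and the others are not. It interpolates between the two distributions to be compared.
\<close>

lemma corank_distribution_discrepancy:
  "\<bar>real (card {xs \<in> tuples A N. dim - rank (set xs) = k}) / card (tuples A N)
      - corank_prob (1 / real q) k N dim\<bar>
    \<le> (\<Sum>i<N. (\<Sum>xs\<in>tuples A i. discrepancy (A i) xs) / card (tuples A i))"
proof -
  define h where "h = corank_prob (1 / real q) k"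
  define G where "G i = (\<Sum>xs\<in>tuples A i. h (N - i) (dim - rank (set xs))) / card (tuples A i)" for i
  define D where "D i = (\<Sum>xs\<in>tuples A i. discrepancy (A i) xs) / card (tuples A i)" for i
  have step: "\<bar>G (Suc i) - G i\<bar> \<le> D i" if i: "i < N" for i
  proof -
    obtain m where m: "N - i = Suc m" "N - Suc i = m"
      using i by (metis Suc_diff_Suc)
    have "G (Suc i) = (\<Sum>xs\<in>tuples A i.
        (\<Sum>v\<in>A i. h m (dim - rank (set (xs @ [v])))) / card (A i)) / card (tuples A i)"
      using card_constraint_pos[of i]
      unfolding G_def sum_tuples_Suc m by (simp add: card_tuples sum_divide_distrib field_simps)
    then have "G (Suc i) - G i = (\<Sum>xs\<in>tuples A i.
        (\<Sum>v\<in>A i. h m (dim - rank (set (xs @ [v])))) / card (A i)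
          - h (Suc m) (dim - rank (set xs))) / card (tuples A i)"
      unfolding G_def m by (simp add: sum_subtractf diff_divide_distrib)
    also have "\<bar>\<dots>\<bar> \<le> D i"
      unfolding D_def abs_divide abs_of_nat
    proof (intro divide_right_mono order_trans[OF sum_abs] sum_mono)
      show "\<bar>(\<Sum>v\<in>A i. h m (dim - rank (set (xs @ [v])))) / card (A i)
          - h (Suc m) (dim - rank (set xs))\<bar> \<le> discrepancy (A i) xs" if "xs \<in> tuples A i" for xs
        unfolding h_def using that by (rule exposure_step)
    qed simp
    finally show ?thesis .
  qed
  have "G N - G 0 = (\<Sum>i<N. G (Suc i) - G i)"
    by (simp add: sum_lessThan_telescope)
  then have "\<bar>G N - G 0\<bar> \<le> (\<Sum>i<N. D i)"
    using step by (auto intro!: order_trans[OF sum_abs] sum_mono)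
  moreover have "G N = real (card {xs \<in> tuples A N. dim - rank (set xs) = k}) / card (tuples A N)"
    using finite_tuples[of A N] finite_constraint
    by (simp add: G_def h_def sum.If_cases Int_def)
  moreover have "G 0 = corank_prob (1 / real q) k N dim"
    by (simp add: G_def h_def tuples_0 rank_empty)
  ultimately show ?thesis
    by (simp add: D_def)
qed

text \<open>
  Both probabilities are at most the size \<open>q\<^sup>d\<close> of the span divided by \<open>|A i|\<close>: the constrained one
  since the span contains the intersection, the unconstrained one since \<open>|A i| \<le> q powr dim\<close>.
\<close>

lemma discrepancy_le_power:
  assumes xs: "xs \<in> tuples A i"
  shows "discrepancy (A i) xs \<le> real q ^ i / card (A i)"
proof -
  have xsV: "set xs \<subseteq> carrier V"
    using xs by (rule set_tuples_subset)
  define d where "d = rank (set xs)"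
  have d: "d \<le> i" "d \<le> dim"
    using rank_le_length[OF xsV] rank_le_dim[OF xsV] xs by (auto simp: d_def tuples_def)
  have q: "1 \<le> real q"
    using q_ge_2 by simp
  have "finite (span (set xs))"
    using span_is_subset2[OF xsV] finite_vectors finite_subset by blast
  then have "card (span (set xs) \<inter> A i) \<le> q ^ d"
    unfolding d_def card_span[OF xsV, symmetric] by (intro card_mono) auto
  also have "\<dots> \<le> q ^ i"
    using q_ge_2 d by (intro power_increasing) auto
  finally have "real (card (span (set xs) \<inter> A i)) \<le> real q ^ i"
    by (metis of_nat_le_iff of_nat_power)
  then have 1: "stay_prob (A i) xs \<le> real q ^ i / card (A i)"
    by (intro divide_right_mono) auto
  have "(1 / real q) ^ (dim - d) = real q ^ d / real q ^ dim"
    using d q by (simp add: power_diff power_one_over field_simps)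
  also have "\<dots> \<le> real q ^ i / card (A i)"
  proof (rule frac_le)
    show "real q ^ d \<le> real q ^ i"
      using d q by (intro power_increasing) auto
    have "card (A i) \<le> q ^ dim"
      unfolding card_eq_power_dim[symmetric] by (intro card_mono finite_vectors constraint_subset)
    then show "real (card (A i)) \<le> real q ^ dim"
      by (metis of_nat_le_iff of_nat_power)
  qed (use card_constraint_pos in auto)
  finally have 2: "(1 / real q) ^ (dim - d) \<le> real q ^ i / card (A i)" .
  have "0 \<le> stay_prob (A i) xs" "0 \<le> (1 / real q) ^ (dim - d)"
    by auto
  with 1 2 show ?thesis
    unfolding discrepancy_def d_def[symmetric] by linarith
qed

lemma discrepancy_le_1: "discrepancy (A i) xs \<le> 1"
proof -
  have "card (span (set xs) \<inter> A i) \<le> card (A i)"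
    by (intro card_mono finite_constraint) auto
  then have "stay_prob (A i) xs \<le> 1"
    using card_constraint_pos[of i] by simp
  moreover have "(1 / real q) ^ (dim - rank (set xs)) \<le> 1"
    using q_ge_2 by (intro power_le_one) auto
  moreover have "0 \<le> stay_prob (A i) xs" "0 \<le> (1 / real q) ^ (dim - rank (set xs))"
    by auto
  ultimately show ?thesis
    unfolding discrepancy_def by linarith
qed

lemma discrepancy_eq_0:
  assumes xs: "xs \<in> tuples A i" and sum: "submodule_sum (span (set xs)) (A i) = carrier V"
  shows "discrepancy (A i) xs = 0"
proof -
  have xsV: "set xs \<subseteq> carrier V"
    using xs by (rule set_tuples_subset)
  have "card (span (set xs) \<inter> A i) * q ^ dim = q ^ rank (set xs) * card (A i)"
    using card_Int_of_sum_eq_carrier[OF span_is_submodule[OF xsV] A sum]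
    by (simp add: card_eq_power_dim card_span[OF xsV])
  then have "real (card (span (set xs) \<inter> A i)) * real q ^ dim = real q ^ rank (set xs) * real (card (A i))"
    by (metis of_nat_mult of_nat_power)
  then have "stay_prob (A i) xs = real q ^ rank (set xs) / real q ^ dim"
    using card_constraint_pos[of i] q_ge_2 by (simp add: field_simps)
  also have "\<dots> = (1 / real q) ^ (dim - rank (set xs))"
    using rank_le_dim[OF xsV] q_ge_2 by (simp add: power_diff power_one_over field_simps)
  finally show ?thesis
    by (simp add: discrepancy_def)
qed

lemma mean_discrepancy_le_power:
  "(\<Sum>xs\<in>tuples A i. discrepancy (A i) xs) / card (tuples A i) \<le> real q ^ i / card (A i)"
proof -
  have "(\<Sum>xs\<in>tuples A i. discrepancy (A i) xs) \<le> (\<Sum>xs\<in>tuples A i. real q ^ i / card (A i))"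
    by (intro sum_mono discrepancy_le_power)
  then show ?thesis
    using card_tuples_pos[of i] by (simp add: field_simps)
qed

lemma mean_discrepancy_le_bad:
  "(\<Sum>xs\<in>tuples A i. discrepancy (A i) xs) / card (tuples A i) \<le>
    real (card {xs \<in> tuples A i. submodule_sum (span (set xs)) (A i) \<noteq> carrier V}) / card (tuples A i)"
proof -
  have "(\<Sum>xs\<in>tuples A i. discrepancy (A i) xs) \<le>
      (\<Sum>xs\<in>tuples A i. if submodule_sum (span (set xs)) (A i) \<noteq> carrier V then 1 else 0)"
    by (intro sum_mono) (simp add: discrepancy_le_1 discrepancy_eq_0)
  also have "\<dots> = real (card {xs \<in> tuples A i. submodule_sum (span (set xs)) (A i) \<noteq> carrier V})"
    using finite_tuples[of A i] finite_constraint by (simp add: sum.If_cases Int_def)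
  finally show ?thesis
    by (intro divide_right_mono) auto
qed

end

end

section \<open>Coordinate spaces and orthogonality\<close>

locale finite_coordinate_space = field K for K (structure) +
  fixes n :: nat
  assumes finite_K: "finite (carrier K)"
begin

abbreviation V where "V \<equiv> vec_module K n"

lemma carrier_V: "carrier V = {v \<in> carrier_vec n. \<forall>i<n. v $ i \<in> carrier K}"
  by (simp add: vec_module_def)

lemma in_carrier_V: "v \<in> carrier V \<longleftrightarrow> dim_vec v = n \<and> (\<forall>i<n. v $ i \<in> carrier K)"
  unfolding carrier_V carrier_vec_def by blast

lemma V_simps:
  "\<zero>\<^bsub>V\<^esub> = vec n (\<lambda>i. \<zero>)"
  "v \<oplus>\<^bsub>V\<^esub> w = vec n (\<lambda>i. v $ i \<oplus> w $ i)"
  "a \<odot>\<^bsub>V\<^esub> v = vec n (\<lambda>i. a \<otimes> v $ i)"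
  by (simp_all add: vec_module_def)

lemma eq_V_iff: "v \<in> carrier V \<Longrightarrow> w \<in> carrier V \<Longrightarrow> v = w \<longleftrightarrow> (\<forall>i<n. v $ i = w $ i)"
  by (auto simp: in_carrier_V intro!: eq_vecI)

definition vanishing :: "nat set \<Rightarrow> 'a vec set" where
  "vanishing F = {v \<in> carrier V. \<forall>i\<in>F. v $ i = \<zero>}"

lemma bij_vanishing:
  assumes F: "F \<subseteq> {..<n}"
  shows "bij_betw (\<lambda>v. restrict (($) v) ({..<n} - F)) (vanishing F) (({..<n} - F) \<rightarrow>\<^sub>E carrier K)"
proof (rule bij_betwI[where g = "\<lambda>f. vec n (\<lambda>i. if i \<in> F then \<zero> else f i)"])
  fix v assume "v \<in> vanishing F"
  then show "vec n (\<lambda>i. if i \<in> F then \<zero> else restrict (($) v) ({..<n} - F) i) = v"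
    by (intro eq_vecI) (auto simp: vanishing_def in_carrier_V)
next
  fix f assume f: "f \<in> ({..<n} - F) \<rightarrow>\<^sub>E carrier K"
  show "restrict (($) (vec n (\<lambda>i. if i \<in> F then \<zero> else f i))) ({..<n} - F) = f"
  proof
    show "restrict (($) (vec n (\<lambda>i. if i \<in> F then \<zero> else f i))) ({..<n} - F) i = f i" for i
      using PiE_arb[OF f, of i] by (simp add: restrict_def)
  qed
next
  show "(\<lambda>v. restrict (($) v) ({..<n} - F)) \<in> vanishing F \<rightarrow> ({..<n} - F) \<rightarrow>\<^sub>E carrier K"
    by (auto simp: vanishing_def in_carrier_V)
  show "(\<lambda>f. vec n (\<lambda>i. if i \<in> F then \<zero> else f i)) \<in> (({..<n} - F) \<rightarrow>\<^sub>E carrier K) \<rightarrow> vanishing F"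
  proof
    fix f assume f: "f \<in> ({..<n} - F) \<rightarrow>\<^sub>E carrier K"
    then have "f i \<in> carrier K" if "i < n" "i \<notin> F" for i
      using that by (auto intro: PiE_mem)
    then show "vec n (\<lambda>i. if i \<in> F then \<zero> else f i) \<in> vanishing F"
      using F by (simp add: vanishing_def in_carrier_V subset_iff)
  qed
qed

lemma card_vanishing:
  assumes "F \<subseteq> {..<n}"
  shows "card (vanishing F) = card (carrier K) ^ (n - card F)"
  using bij_betw_same_card[OF bij_vanishing[OF assms]] assms finite_subset[OF assms]
  by (simp add: card_PiE card_Diff_subset)

lemma finite_V: "finite (carrier V)"
proof -
  have "vanishing {} = carrier V"
    by (simp add: vanishing_def)
  moreover have "finite (({..<n} - {}) \<rightarrow>\<^sub>E carrier K)"
    using finite_K by (intro finite_PiE) auto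
  ultimately show ?thesis
    using bij_betw_finite[OF bij_vanishing[of "{}"]] by simp
qed

sublocale VS: finite_vectorspace K V
  using vectorspace_vec_module[OF field_axioms, of n] finite_K finite_V
  by (simp add: finite_vectorspace_def finite_vectorspace_axioms_def)

lemma dim_V: "VS.dim = n"
proof -
  have "VS.q ^ VS.dim = VS.q ^ n"
    unfolding VS.card_eq_power_dim[symmetric] using card_vanishing[of "{}"]
    by (simp add: vanishing_def)
  then show ?thesis
    using VS.q_ge_2 by (simp add: power_inject_exp)
qed

lemma submodule_vanishing:
  assumes "F \<subseteq> {..<n}"
  shows "submodule K (vanishing F) V"
  using assms VS.module_axioms
  by (auto simp: submodule_def vanishing_def in_carrier_V V_simps subset_iff)

definition dot :: "'a vec \<Rightarrow> 'a vec \<Rightarrow> 'a" where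
  "dot w v = (\<Oplus>k\<in>{..<n}. w $ k \<otimes> v $ k)"

lemma dot_closed: "w \<in> carrier V \<Longrightarrow> v \<in> carrier V \<Longrightarrow> dot w v \<in> carrier K"
  unfolding dot_def by (intro finsum_closed) (auto simp: in_carrier_V)

lemma dot_commute: "w \<in> carrier V \<Longrightarrow> v \<in> carrier V \<Longrightarrow> dot w v = dot v w"
  unfolding dot_def by (intro finsum_cong') (auto simp: in_carrier_V m_comm)

lemma dot_add:
  assumes "w \<in> carrier V" "u \<in> carrier V" "v \<in> carrier V"
  shows "dot w (u \<oplus>\<^bsub>V\<^esub> v) = dot w u \<oplus> dot w v"
proof -
  have "dot w (u \<oplus>\<^bsub>V\<^esub> v) = (\<Oplus>k\<in>{..<n}. (w $ k \<otimes> u $ k) \<oplus> (w $ k \<otimes> v $ k))"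
    unfolding dot_def using assms by (intro finsum_cong') (auto simp: in_carrier_V V_simps r_distr)
  also have "\<dots> = dot w u \<oplus> dot w v"
    unfolding dot_def using assms by (intro finsum_addf) (auto simp: in_carrier_V)
  finally show ?thesis .
qed

lemma dot_smult:
  assumes "w \<in> carrier V" "v \<in> carrier V" "a \<in> carrier K"
  shows "dot w (a \<odot>\<^bsub>V\<^esub> v) = a \<otimes> dot w v"
proof -
  have "dot w (a \<odot>\<^bsub>V\<^esub> v) = (\<Oplus>k\<in>{..<n}. a \<otimes> (w $ k \<otimes> v $ k))"
    unfolding dot_def using assms by (intro finsum_cong') (auto simp: in_carrier_V V_simps m_lcomm)
  also have "\<dots> = a \<otimes> dot w v"
    unfolding dot_def using assms by (intro finsum_rdistr[symmetric]) (auto simp: in_carrier_V)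
  finally show ?thesis .
qed

lemma dot_zero: "w \<in> carrier V \<Longrightarrow> dot w \<zero>\<^bsub>V\<^esub> = \<zero>"
  using dot_smult[of w "\<zero>\<^bsub>V\<^esub>" \<zero>] dot_closed[of w "\<zero>\<^bsub>V\<^esub>"] by simp

definition orth :: "'a vec \<Rightarrow> 'a vec set" where
  "orth w = {v \<in> carrier V. dot w v = \<zero>}"

lemma submodule_orth: "w \<in> carrier V \<Longrightarrow> submodule K (orth w) V"
  using VS.module_axioms
  by (auto simp: submodule_def orth_def dot_add dot_smult dot_zero)

definition unit_vector :: "nat \<Rightarrow> 'a vec" where
  "unit_vector k = vec n (\<lambda>i. if i = k then \<one> else \<zero>)"

lemma unit_vector_carrier: "unit_vector k \<in> carrier V"
  by (simp add: in_carrier_V unit_vector_def)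

lemma dot_unit_vector:
  assumes "w \<in> carrier V" "k < n"
  shows "dot w (unit_vector k) = w $ k"
proof -
  have "dot w (unit_vector k) = (\<Oplus>i\<in>{..<n}. if k = i then w $ i else \<zero>)"
    unfolding dot_def using assms by (intro finsum_cong') (auto simp: in_carrier_V unit_vector_def)
  also have "\<dots> = w $ k"
    using assms by (intro finsum_singleton) (auto simp: in_carrier_V)
  finally show ?thesis .
qed

text \<open>
  Duality by counting: a basis of \<open>U\<close> has fewer than \<open>n\<close> elements, so there are more vectors \<open>w\<close> than
  possible values of \<open>dot w\<close> on the basis, and the difference of two vectors with equal values is
  orthogonal to \<open>U\<close>.
\<close>

lemma proper_subspace_orth:
  assumes U: "submodule K U V" and proper: "U \<noteq> carrier V"
  obtains w where "w \<in> carrier V" "w \<noteq> \<zero>\<^bsub>V\<^esub>" "U \<subseteq> orth w"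
proof -
  obtain B where B: "finite B" "B \<subseteq> carrier V" "VS.span B = U" "card U = VS.q ^ card B"
    using VS.submodule_basis[OF U] by metis
  define T where "T w = restrict (dot w) B" for w
  have "U \<subset> carrier V"
    using U proper by (auto simp: submodule_def)
  then have "VS.q ^ card B < card (carrier V)"
    unfolding B(4)[symmetric] by (intro psubset_card_mono finite_V)
  moreover have "card (T ` carrier V) \<le> VS.q ^ card B"
  proof -
    have "T ` carrier V \<subseteq> (B \<rightarrow>\<^sub>E carrier K)"
      using B(2) dot_closed by (auto simp: T_def)
    then have "card (T ` carrier V) \<le> card (B \<rightarrow>\<^sub>E carrier K)"
      using B(1) finite_K by (intro card_mono finite_PiE) auto
    then show ?thesis
      using B(1) by (simp add: card_PiE)
  qed
  ultimately have "\<not> inj_on T (carrier V)"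
    by (intro pigeonhole) simp
  then obtain u w where uw: "u \<in> carrier V" "w \<in> carrier V" "u \<noteq> w" "T u = T w"
    by (auto simp: inj_on_def)
  define d where "d = u \<ominus>\<^bsub>V\<^esub> w"
  have d: "d \<in> carrier V" "d \<oplus>\<^bsub>V\<^esub> w = u"
    using uw by (simp_all add: d_def a_minus_def VS.M.a_assoc VS.M.l_neg)
  have "B \<subseteq> orth d"
  proof
    fix b assume b: "b \<in> B"
    have bV: "b \<in> carrier V"
      using b B(2) by auto
    have "dot b d \<oplus> dot b w = dot b u"
      using dot_add[OF bV d(1) uw(2)] d(2) by simp
    moreover have "dot b w = dot b u"
      using fun_cong[OF uw(4), of b] b dot_commute[OF bV uw(1)] dot_commute[OF bV uw(2)]
      by (simp add: T_def)
    ultimately have "dot b d = \<zero>"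
      using bV d(1) uw dot_closed add.l_cancel_one by (metis add.r_cancel_one)
    then show "b \<in> orth d"
      using bV d(1) dot_commute by (simp add: orth_def)
  qed
  then have "U \<subseteq> orth d"
    using VS.span_is_subset[OF _ submodule_orth[OF d(1)]] B(3) by blast
  moreover have "d \<noteq> \<zero>\<^bsub>V\<^esub>"
    using d(2) uw by auto
  ultimately show ?thesis
    using that d(1) by blast
qed

text \<open>
  If coordinate \<open>k\<close> is free in \<open>vanishing F\<close> and \<open>w\<close> has a nonzero entry there, then moving a vector
  orthogonal to \<open>w\<close> in direction \<open>k\<close> changes its product with \<open>w\<close>. So the \<open>q\<close> translates of the
  set of orthogonal vectors in this direction are disjoint, and orthogonality has probability at most \<open>1/q\<close>.
\<close>

lemma card_vanishing_orth:
  assumes w: "w \<in> carrier V" and k: "k < n" "w $ k \<noteq> \<zero>" and F: "F \<subseteq> {..<n}" "k \<notin> F"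
  shows "VS.q * card (vanishing F \<inter> orth w) \<le> card (vanishing F)"
proof -
  interpret F: submodule K "vanishing F" V
    using F(1) by (rule submodule_vanishing)
  have unit_vector_F: "unit_vector k \<in> vanishing F"
    using F k(1) by (auto simp: vanishing_def unit_vector_carrier) (auto simp: unit_vector_def subset_iff)
  define g where "g = (\<lambda>(v, a). v \<oplus>\<^bsub>V\<^esub> (a \<odot>\<^bsub>V\<^esub> unit_vector k))"
  have "inj_on g ((vanishing F \<inter> orth w) \<times> carrier K)"
  proof (rule inj_onI, clarify)
    fix v a u b
    assume v: "v \<in> vanishing F" "v \<in> orth w" and a: "a \<in> carrier K"
      and u: "u \<in> vanishing F" "u \<in> orth w" and b: "b \<in> carrier K"
      and eq: "g (v, a) = g (u, b)"
    have vu: "v \<in> carrier V" "u \<in> carrier V" "dot w v = \<zero>" "dot w u = \<zero>"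
      using v u by (auto simp: orth_def)
    have wk: "w $ k \<in> carrier K"
      using w k by (simp add: in_carrier_V)
    have "dot w (g (v, a)) = a \<otimes> w $ k" "dot w (g (u, b)) = b \<otimes> w $ k"
      using w vu a b wk unit_vector_carrier k by (simp_all add: g_def dot_add dot_smult dot_unit_vector)
    then have "a = b"
      using eq a b wk k m_rcancel by metis
    then show "v = u \<and> a = b"
      using eq vu b unit_vector_carrier by (simp add: g_def)
  qed
  then have "card (g ` ((vanishing F \<inter> orth w) \<times> carrier K)) = card (vanishing F \<inter> orth w) * VS.q"
    by (simp add: card_image card_cartesian_product)
  moreover have "g ` ((vanishing F \<inter> orth w) \<times> carrier K) \<subseteq> vanishing F"
    using unit_vector_F by (auto simp: g_def)
  moreover have "finite (vanishing F)"
    using F.subset finite_V finite_subset by blast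
  ultimately show ?thesis
    using card_mono by (metis mult.commute)
qed

text \<open>
  A union bound over the nonzero \<open>w\<close> supported in \<open>F i\<close>: by duality the span and \<open>vanishing (F i)\<close> fail
  to generate the space only if some such \<open>w\<close> is orthogonal to all columns exposed before. For a fixed
  \<open>w\<close>, choose \<open>k\<close> in its support; each of the at least \<open>L\<close> earlier columns free at \<open>k\<close> contributes a
  factor \<open>1/q\<close>.
\<close>

lemma card_bad_tuples:
  assumes F: "\<And>j. F j \<subseteq> {..<n}"
    and L: "\<And>k. k \<in> F i \<Longrightarrow> L \<le> card {j. j < i \<and> k \<notin> F j}"
  shows "card {xs \<in> tuples (vanishing \<circ> F) i.
      VS.submodule_sum (VS.span (set xs)) (vanishing (F i)) \<noteq> carrier V} * VS.q ^ L
    \<le> VS.q ^ card (F i) * card (tuples (vanishing \<circ> F) i)" (is "card ?bad * _ \<le> _")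
proof -
  define T where "T = tuples (vanishing \<circ> F) i"
  define Z where "Z = vanishing ({..<n} - F i) - {\<zero>\<^bsub>V\<^esub>}"
  define T' where "T' w = tuples (\<lambda>j. vanishing (F j) \<inter> orth w) i" for w
  have fin_van: "finite (vanishing G)" for G
    using finite_V by (auto simp: vanishing_def)
  have bad_subset: "?bad \<subseteq> (\<Union>w\<in>Z. T' w)"
  proof
    fix xs assume xs: "xs \<in> ?bad"
    have xsV: "set xs \<subseteq> carrier V"
      using xs by (auto simp: tuples_def in_set_conv_nth vanishing_def)
    let ?U = "VS.submodule_sum (VS.span (set xs)) (vanishing (F i))"
    have sp: "submodule K (VS.span (set xs)) V" and va: "submodule K (vanishing (F i)) V"
      using VS.span_is_submodule[OF xsV] submodule_vanishing[OF F] by auto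
    have U: "submodule K ?U V"
      using VS.sum_is_subspace[of "VS.span (set xs)" "vanishing (F i)"] sp va VS.vectorspace_axioms
      by (simp add: subspace_def)
    obtain w where w: "w \<in> carrier V" "w \<noteq> \<zero>\<^bsub>V\<^esub>" "?U \<subseteq> orth w"
      using proper_subspace_orth[OF U] xs by auto
    have sub: "VS.span (set xs) \<subseteq> ?U" "vanishing (F i) \<subseteq> ?U"
      using VS.in_sum_vs VS.vsum_comm sp va VS.vectorspace_axioms by (simp_all add: subspace_def) (metis)
    have "w $ k = \<zero>" if k: "k < n" "k \<notin> F i" for k
    proof -
      have "unit_vector k \<in> vanishing (F i)"
        using F[of i] k by (auto simp: vanishing_def unit_vector_carrier) (auto simp: unit_vector_def subset_iff)
      then have "dot w (unit_vector k) = \<zero>"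
        using sub w by (auto simp: orth_def)
      then show ?thesis
        using dot_unit_vector w k by simp
    qed
    then have "w \<in> Z"
      using w by (auto simp: Z_def vanishing_def)
    moreover have "set xs \<subseteq> orth w"
      using VS.in_own_span[OF xsV] sub w by auto
    then have "xs \<in> T' w"
      using xs nth_mem[of _ xs] by (simp add: T'_def tuples_def subset_iff)
    ultimately show "xs \<in> (\<Union>w\<in>Z. T' w)"
      by blast
  qed
  have card_T': "card (T' w) * VS.q ^ L \<le> card T" if wZ: "w \<in> Z" for w
  proof -
    have w: "w \<in> carrier V" "\<forall>k<n. k \<notin> F i \<longrightarrow> w $ k = \<zero>" "w \<noteq> \<zero>\<^bsub>V\<^esub>"
      using wZ by (auto simp: Z_def vanishing_def)
    obtain k where k: "k < n" "w $ k \<noteq> \<zero>"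
      using w(3) eq_V_iff[OF w(1) VS.M.zero_closed] by (auto simp: V_simps)
    have kF: "k \<in> F i"
      using w k by auto
    define J where "J = {j. j < i \<and> k \<notin> F j}"
    have "card (T' w) * VS.q ^ L \<le> card (T' w) * VS.q ^ card J"
      using L[OF kF] VS.q_ge_2 by (intro mult_left_mono power_increasing) (auto simp: J_def)
    also have "\<dots> = (\<Prod>j<i. (if j \<in> J then VS.q else 1) * card (vanishing (F j) \<inter> orth w))"
    proof -
      have "VS.q ^ card J = (\<Prod>j\<in>{..<i} \<inter> J. VS.q)"
      proof -
        have "{..<i} \<inter> J = J"
          by (auto simp: J_def)
        then show ?thesis
          by simp
      qed
      also have "\<dots> = (\<Prod>j<i. if j \<in> J then VS.q else 1)"
        by (rule prod.inter_restrict) simp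
      finally show ?thesis
        unfolding T'_def card_tuples prod.distrib by (metis mult.commute)
    qed
    also have "\<dots> \<le> (\<Prod>j<i. card (vanishing (F j)))"
    proof (rule prod_mono, safe)
      show "(if j \<in> J then VS.q else 1) * card (vanishing (F j) \<inter> orth w) \<le> card (vanishing (F j))" for j
      proof (cases "j \<in> J")
        case True
        then show ?thesis
          using card_vanishing_orth[OF w(1) k F] by (simp add: J_def)
      next
        case False
        then show ?thesis
          using fin_van by (simp add: card_mono)
      qed
    qed
    also have "\<dots> = card T"
      by (simp add: T_def card_tuples)
    finally show ?thesis .
  qed
  have fin_T': "finite (T' w)" for w
    unfolding T'_def by (rule finite_tuples) (simp add: fin_van)
  have fin_Z: "finite Z"
    by (simp add: Z_def fin_van)
  have "card ?bad * VS.q ^ L \<le> (\<Sum>w\<in>Z. card (T' w)) * VS.q ^ L"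
  proof (rule mult_right_mono)
    have "card ?bad \<le> card (\<Union>w\<in>Z. T' w)"
      using bad_subset fin_T' fin_Z by (intro card_mono) auto
    also have "\<dots> \<le> (\<Sum>w\<in>Z. card (T' w))"
      using fin_Z by (rule card_UN_le)
    finally show "card ?bad \<le> (\<Sum>w\<in>Z. card (T' w))" .
  qed simp
  also have "\<dots> = (\<Sum>w\<in>Z. card (T' w) * VS.q ^ L)"
    by (rule sum_distrib_right)
  also have "\<dots> \<le> (\<Sum>w\<in>Z. card T)"
    using card_T' by (intro sum_mono)
  also have "\<dots> \<le> VS.q ^ card (F i) * card T"
  proof -
    have "finite (F i)"
      using F finite_subset by blast
    then have "n - card ({..<n} - F i) = card (F i)"
      using F[of i] card_mono[of "{..<n}" "F i"] by (simp add: card_Diff_subset)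
    then have "card (vanishing ({..<n} - F i)) = VS.q ^ card (F i)"
      using card_vanishing[of "{..<n} - F i"] by simp
    moreover have "card Z \<le> card (vanishing ({..<n} - F i))"
      unfolding Z_def by (intro card_mono fin_van) auto
    ultimately show ?thesis
      by simp
  qed
  finally show ?thesis
    by (simp add: T_def)
qed

end

section \<open>The error bound\<close>

context finite_coordinate_space
begin

lemma card_rank_matrices:
  assumes F: "\<And>j. F j \<subseteq> {..<n}"
  shows "card (rank_matrices_with_zeros K n r F) =
    card {xs \<in> tuples (vanishing \<circ> F) n. VS.rank (set xs) = r}"
proof (rule bij_betw_same_card)
  show "bij_betw cols (rank_matrices_with_zeros K n r F)
      {xs \<in> tuples (vanishing \<circ> F) n. VS.rank (set xs) = r}"
  proof (rule bij_betwI[where g = "mat_of_cols n"])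
    show "cols \<in> rank_matrices_with_zeros K n r F \<rightarrow>
        {xs \<in> tuples (vanishing \<circ> F) n. VS.rank (set xs) = r}"
    proof
      fix A assume A: "A \<in> rank_matrices_with_zeros K n r F"
      have dim: "A \<in> carrier_mat n n" and rank: "mat_rank K n A = r"
        and zero: "\<And>i k. i < n \<Longrightarrow> k \<in> F i \<Longrightarrow> A $$ (k, i) = \<zero>"
        using A by (auto simp: rank_matrices_with_zeros_def)
      have entry: "A $$ (k, i) \<in> carrier K" if "i < n" "k < n" for i k
      proof -
        have "A $$ (k, i) \<in> elements_mat A"
          using that dim by (intro elements_matI) auto
        then show ?thesis
          using A by (auto simp: rank_matrices_with_zeros_def)
      qed
      have "col A i \<in> vanishing (F i)" if i: "i < n" for i
        using i dim entry[OF i] zero[OF i] F[of i]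
        by (auto simp: vanishing_def in_carrier_V subset_iff)
      then have "cols A \<in> tuples (vanishing \<circ> F) n"
        using dim by (simp add: tuples_def)
      then show "cols A \<in> {xs \<in> tuples (vanishing \<circ> F) n. VS.rank (set xs) = r}"
        using rank by (simp add: mat_rank_def)
    qed
    show "mat_of_cols n \<in> {xs \<in> tuples (vanishing \<circ> F) n. VS.rank (set xs) = r} \<rightarrow>
        rank_matrices_with_zeros K n r F"
    proof
      fix xs assume xs: "xs \<in> {xs \<in> tuples (vanishing \<circ> F) n. VS.rank (set xs) = r}"
      have len: "length xs = n" and nth: "\<And>j. j < n \<Longrightarrow> xs ! j \<in> vanishing (F j)"
        using xs by (auto simp: tuples_def)
      have "set xs \<subseteq> carrier_vec n"
        using len nth by (auto simp: in_set_conv_nth vanishing_def carrier_V)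
      then have cols: "cols (mat_of_cols n xs) = xs"
        by (intro cols_mat_of_cols)
      have "elements_mat (mat_of_cols n xs) \<subseteq> carrier K"
        using len nth by (auto simp: elements_mat_def mat_of_cols_def vanishing_def in_carrier_V)
      moreover have "mat_of_cols n xs $$ (k, i) = \<zero>" if "i < n" "k \<in> F i" for i k
        using that nth[of i] F[of i] len by (auto simp: mat_of_cols_def vanishing_def subset_iff)
      ultimately show "mat_of_cols n xs \<in> rank_matrices_with_zeros K n r F"
        using xs len mat_of_cols_carrier(1)[of n xs]
        by (simp add: rank_matrices_with_zeros_def mat_rank_def cols)
    qed
    show "mat_of_cols n (cols A) = A" if "A \<in> rank_matrices_with_zeros K n r F" for A
      using that mat_of_cols_cols[of A] by (auto simp: rank_matrices_with_zeros_def)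
    show "cols (mat_of_cols n xs) = xs"
      if "xs \<in> {xs \<in> tuples (vanishing \<circ> F) n. VS.rank (set xs) = r}" for xs
      using that by (intro cols_mat_of_cols)
        (auto simp: tuples_def in_set_conv_nth vanishing_def carrier_V)
  qed
qed

text \<open>
  The constants come from bounding every mean discrepancy by \<open>q powr (-5\<alpha>n)\<close>. One \<open>\<alpha>n\<close> of the exponent
  pays for the number \<open>n\<close> of steps, since \<open>\<alpha>n / 2 \<le> 2 powr (\<alpha>n) \<le> q powr (\<alpha>n)\<close>; this leaves
  \<open>4\<alpha>n\<close> and the factor \<open>2 / \<alpha>\<close>. The condition \<open>4\<alpha> \<le> 1\<close> bounds the error \<open>4 q powr (-n)\<close> of the
  unconstrained chain by \<open>4 q powr (-4\<alpha>n)\<close>.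
\<close>

lemma rank_distribution_bound:
  fixes \<alpha> :: real
  assumes F: "\<And>j. F j \<subseteq> {..<n}"
    and \<alpha>: "0 < \<alpha>" "4 * \<alpha> \<le> 1"
    and sparse: "\<And>i. i < n \<Longrightarrow> real (card (F i)) \<le> \<alpha> * real n"
    and rows: "\<And>k. k < n \<Longrightarrow> real (card {j. j < n \<and> k \<in> F j}) \<le> (1 - 12 * \<alpha>) * real n"
    and r: "r \<le> n"
  shows "\<bar>real (card (rank_matrices_with_zeros K n r F)) / real VS.q ^ (n\<^sup>2 - (\<Sum>i<n. card (F i)))
      - pmf (Q_infty VS.q) (n - r)\<bar>
    \<le> (2 / \<alpha> + 4) * (1 / real VS.q) powr (4 * \<alpha> * real n)"
proof -
  define A where "A = vanishing \<circ> F"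
  define a where "a = \<alpha> * real n"
  define q where "q = real VS.q"
  have q: "2 \<le> q"
    using VS.q_ge_2 by (simp add: q_def)
  have A: "submodule K (A j) V" for j
    by (simp add: A_def submodule_vanishing[OF F])
  have finF: "finite (F j)" for j
    using F finite_subset by blast
  have cardF: "card (F j) \<le> n" for j
    using card_mono[OF _ F[of j]] by simp
  define D where "D i = (\<Sum>xs\<in>tuples A i. VS.discrepancy (A i) xs) / card (tuples A i)" for i
  have D: "D i \<le> q powr (- 5 * a)" if i: "i < n" for i
  \<comment> \<open>The exponents \<open>a - (n - i)\<close> and \<open>(n - i) - 11 a\<close> of the two bounds agree at \<open>n - i = 6 a\<close>.\<close>
  proof (cases "6 * a \<le> real n - real i")
    case True
    have "D i \<le> q ^ i / q ^ (n - card (F i))"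
      using VS.mean_discrepancy_le_power[of A i, OF A] card_vanishing[OF F[of i]]
      by (simp add: D_def A_def q_def)
    also have "\<dots> = q powr (real i - real (n - card (F i)))"
      using q by (simp add: powr_diff powr_realpow)
    also have "\<dots> \<le> q powr (- 5 * a)"
      using True sparse[OF i] cardF[of i] q by (intro powr_mono) (auto simp: a_def of_nat_diff)
    finally show ?thesis .
  next
    case False
    \<comment> \<open>Of the \<open>i\<close> columns exposed so far, all but at most \<open>(1 - 12\<alpha>) n\<close> are free at any given row.\<close>
    define L where "L = nat \<lceil>real i - (1 - 12 * \<alpha>) * real n\<rceil>"
    have L: "L \<le> card {j. j < i \<and> k \<notin> F j}" if k: "k \<in> F i" for k
    proof -
      have "i \<le> card ({j. j < i \<and> k \<notin> F j} \<union> {j. j < n \<and> k \<in> F j})"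
      proof -
        have "{..<i} \<subseteq> {j. j < i \<and> k \<notin> F j} \<union> {j. j < n \<and> k \<in> F j}"
          using i by auto
        then show ?thesis
          using card_mono[of "{j. j < i \<and> k \<notin> F j} \<union> {j. j < n \<and> k \<in> F j}" "{..<i}"] by simp
      qed
      also have "\<dots> \<le> card {j. j < i \<and> k \<notin> F j} + card {j. j < n \<and> k \<in> F j}"
        by (rule card_Un_le)
      finally have "real i \<le> real (card {j. j < i \<and> k \<notin> F j}) + real (card {j. j < n \<and> k \<in> F j})"
        by linarith
      moreover have "k < n"
        using k F[of i] by auto
      ultimately have "real i - (1 - 12 * \<alpha>) * real n \<le> real (card {j. j < i \<and> k \<notin> F j})"
        using rows[of k] by linarith
      then show ?thesis
        unfolding L_def by linarith
    qed
    define bad where "bad = {xs \<in> tuples A i. VS.submodule_sum (VS.span (set xs)) (A i) \<noteq> carrier V}"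
    have "real (card bad) * q ^ L \<le> q ^ card (F i) * real (card (tuples A i))"
      using card_bad_tuples[of F i L, OF F L] unfolding bad_def A_def q_def
      by (simp flip: of_nat_power of_nat_mult)
    then have "real (card bad) / real (card (tuples A i)) \<le> q ^ card (F i) / q ^ L"
      using VS.card_tuples_pos[of A i, OF A] q by (simp add: field_simps)
    then have "D i \<le> q ^ card (F i) / q ^ L"
      using VS.mean_discrepancy_le_bad[of A i, OF A] unfolding D_def bad_def by linarith
    also have "\<dots> = q powr (real (card (F i)) - real L)"
      using q by (simp add: powr_diff powr_realpow)
    also have "\<dots> \<le> q powr (- 5 * a)"
    proof (rule powr_mono)
      have "real i - (1 - 12 * \<alpha>) * real n \<le> real L"
        unfolding L_def by linarith
      then show "real (card (F i)) - real L \<le> - 5 * a"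
        using False sparse[OF i] by (simp add: a_def algebra_simps)
    qed (use q in simp)
    finally show ?thesis .
  qed
  define p where "p = real (card {xs \<in> tuples A n. VS.dim - VS.rank (set xs) = n - r}) / card (tuples A n)"
  have p: "p = real (card (rank_matrices_with_zeros K n r F)) / q ^ (n\<^sup>2 - (\<Sum>i<n. card (F i)))"
  proof -
    have "VS.dim - VS.rank (set xs) = n - r \<longleftrightarrow> VS.rank (set xs) = r" if "xs \<in> tuples A n" for xs
      using VS.rank_le_dim[OF VS.set_tuples_subset[of A, OF A that]] r unfolding dim_V by linarith
    then have "{xs \<in> tuples A n. VS.dim - VS.rank (set xs) = n - r} = {xs \<in> tuples A n. VS.rank (set xs) = r}"
      by blast
    moreover have "card (tuples A n) = VS.q ^ (n\<^sup>2 - (\<Sum>i<n. card (F i)))"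
    proof -
      have "card (tuples A n) = VS.q ^ (\<Sum>i<n. n - card (F i))"
        by (simp add: card_tuples A_def card_vanishing[OF F] power_sum)
      also have "(\<Sum>i<n. n - card (F i)) = n\<^sup>2 - (\<Sum>i<n. card (F i))"
        using cardF by (subst sum_subtractf_nat) (auto simp: power2_eq_square)
      finally show ?thesis .
    qed
    ultimately show ?thesis
      unfolding p_def card_rank_matrices[OF F] A_def by (simp add: q_def)
  qed
  have "\<bar>p - corank_prob (1 / q) (n - r) n n\<bar> \<le> (\<Sum>i<n. D i)"
    using VS.corank_distribution_discrepancy[of A n "n - r", OF A]
    unfolding p_def D_def q_def dim_V .
  also have "\<dots> \<le> real n * q powr (- 5 * a)"
    using sum_bounded_above[of "{..<n}" D "q powr (- 5 * a)"] D by simp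
  also have "\<dots> \<le> 2 / \<alpha> * q powr (- 4 * a)"
  proof -
    have a: "0 \<le> a"
      using \<alpha> by (simp add: a_def)
    have "a / 2 \<le> a * ln 2"
      using ln2_ge_two_thirds a by (simp add: mult_left_mono[of "1 / 2" "ln 2" a, simplified])
    also have "\<dots> \<le> exp (a * ln 2)"
      using exp_ge_add_one_self[of "a * ln 2"] by linarith
    also have "\<dots> = 2 powr a"
      by (simp add: powr_def)
    also have "\<dots> \<le> q powr a"
      using q a by (intro powr_mono2) auto
    finally have "real n \<le> 2 / \<alpha> * q powr a"
      using \<alpha> by (simp add: a_def field_simps)
    then have "real n * q powr (- 5 * a) \<le> 2 / \<alpha> * q powr a * q powr (- 5 * a)"
      by (intro mult_right_mono) auto
    also have "\<dots> = 2 / \<alpha> * q powr (- 4 * a)"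
      by (simp flip: powr_add)
    finally show ?thesis .
  qed
  finally have 1: "\<bar>p - corank_prob (1 / q) (n - r) n n\<bar> \<le> 2 / \<alpha> * q powr (- 4 * a)" .
  have "\<bar>corank_prob (1 / q) (n - r) n n - pmf (Q_infty VS.q) (n - r)\<bar> \<le> 4 * (1 / q) ^ n"
    unfolding q_def by (rule corank_prob_approx_Q_infty) (use VS.q_ge_2 in auto)
  also have "(1 / q) ^ n = q powr (- real n)"
    using q by (simp add: powr_minus powr_realpow power_one_over field_simps)
  also have "4 * \<dots> \<le> 4 * q powr (- 4 * a)"
  proof -
    have "4 * \<alpha> * real n \<le> 1 * real n"
      using \<alpha> by (intro mult_right_mono) auto
    then show ?thesis
      using q by (intro mult_left_mono powr_mono) (auto simp: a_def)
  qed
  finally have 2: "\<bar>corank_prob (1 / q) (n - r) n n - pmf (Q_infty VS.q) (n - r)\<bar>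
      \<le> 4 * q powr (- 4 * a)" .
  have "\<bar>p - pmf (Q_infty VS.q) (n - r)\<bar> \<le> (2 / \<alpha> + 4) * q powr (- 4 * a)"
    using 1 2 unfolding distrib_right by linarith
  also have "q powr (- 4 * a) = (1 / q) powr (4 * \<alpha> * real n)"
    using q by (simp add: a_def powr_minus powr_divide field_simps)
  finally show ?thesis
    unfolding p by (simp add: q_def)
qed

end

theorem corollary1p5:
  shows "\<exists>\<alpha>\<^sub>0::real. \<alpha>\<^sub>0 > 0 \<and>
    (\<forall>\<alpha>::real. 0 < \<alpha> \<and> \<alpha> \<le> \<alpha>\<^sub>0 \<longrightarrow>
      (\<exists>(C'::real) (c::real) (B::real). C' > 0 \<and> c > 0 \<and> B \<ge> 0 \<and>
        (\<forall>(q::nat) (n::nat) (K::nat ring) (F::nat \<Rightarrow> nat set) (r::nat).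
          primepow q \<and> n \<ge> 1 \<and>
          field K \<and> finite (carrier K) \<and> card (carrier K) = q \<and>
          (\<forall>i<n. F i \<subseteq> {..<n}) \<and>
          (\<forall>i<n. real (card (F i)) < \<alpha> * real n) \<and>
          (\<forall>k<n. real (card {j. j < n \<and> k \<in> F j}) \<le> (1 - 12 * \<alpha>) * real n) \<and>
          (1 - \<alpha>) * real n \<le> real r \<and> r \<le> n \<longrightarrow>
          (\<exists>E::real.
            real (card (rank_matrices_with_zeros K n r F)) =
              real q ^ (n\<^sup>2 - (\<Sum>i<n. card (F i))) * (pmf (Q_infty q) (n - r) + E) \<and>
            \<bar>E\<bar> \<le> B * (C' / real q) powr (c * real n)))))"
proof (rule exI[of _ "1 / 4"], intro conjI allI impI)
  fix \<alpha> :: real assume \<alpha>: "0 < \<alpha> \<and> \<alpha> \<le> 1 / 4"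
  show "\<exists>(C'::real) (c::real) (B::real). C' > 0 \<and> c > 0 \<and> B \<ge> 0 \<and>
        (\<forall>(q::nat) (n::nat) (K::nat ring) (F::nat \<Rightarrow> nat set) (r::nat).
          primepow q \<and> n \<ge> 1 \<and>
          field K \<and> finite (carrier K) \<and> card (carrier K) = q \<and>
          (\<forall>i<n. F i \<subseteq> {..<n}) \<and>
          (\<forall>i<n. real (card (F i)) < \<alpha> * real n) \<and>
          (\<forall>k<n. real (card {j. j < n \<and> k \<in> F j}) \<le> (1 - 12 * \<alpha>) * real n) \<and>
          (1 - \<alpha>) * real n \<le> real r \<and> r \<le> n \<longrightarrow>
          (\<exists>E::real.
            real (card (rank_matrices_with_zeros K n r F)) =
              real q ^ (n\<^sup>2 - (\<Sum>i<n. card (F i))) * (pmf (Q_infty q) (n - r) + E) \<and>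
            \<bar>E\<bar> \<le> B * (C' / real q) powr (c * real n)))"
  proof (rule exI[of _ 1], rule exI[of _ "4 * \<alpha>"], rule exI[of _ "2 / \<alpha> + 4"], intro conjI allI impI)
    fix q n r :: nat and K :: "nat ring" and F :: "nat \<Rightarrow> nat set"
    assume asm: "primepow q \<and> n \<ge> 1 \<and>
          field K \<and> finite (carrier K) \<and> card (carrier K) = q \<and>
          (\<forall>i<n. F i \<subseteq> {..<n}) \<and>
          (\<forall>i<n. real (card (F i)) < \<alpha> * real n) \<and>
          (\<forall>k<n. real (card {j. j < n \<and> k \<in> F j}) \<le> (1 - 12 * \<alpha>) * real n) \<and>
          (1 - \<alpha>) * real n \<le> real r \<and> r \<le> n"
    interpret finite_coordinate_space K n
      using asm by (simp add: finite_coordinate_space_def finite_coordinate_space_axioms_def)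
    \<comment> \<open>Nothing is known about \<open>F\<close> beyond the \<open>n\<close> columns; an infinite sequence of constraints is needed.\<close>
    define F' where "F' j = (if j < n then F j else {})" for j
    have same: "rank_matrices_with_zeros K n r F' = rank_matrices_with_zeros K n r F"
        "(\<Sum>i<n. card (F' i)) = (\<Sum>i<n. card (F i))"
      by (simp_all add: rank_matrices_with_zeros_def F'_def)
    define N where "N = real q ^ (n\<^sup>2 - (\<Sum>i<n. card (F i)))"
    have "N > 0"
      using asm VS.q_ge_2 by (simp add: N_def)
    have "\<bar>real (card (rank_matrices_with_zeros K n r F')) / real VS.q ^ (n\<^sup>2 - (\<Sum>i<n. card (F' i)))
        - pmf (Q_infty VS.q) (n - r)\<bar> \<le> (2 / \<alpha> + 4) * (1 / real VS.q) powr (4 * \<alpha> * real n)"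
    proof (rule rank_distribution_bound)
      show "F' j \<subseteq> {..<n}" for j
        using asm by (simp add: F'_def)
      show "real (card (F' i)) \<le> \<alpha> * real n" if "i < n" for i
        using asm that by (simp add: F'_def less_imp_le)
      show "real (card {j. j < n \<and> k \<in> F' j}) \<le> (1 - 12 * \<alpha>) * real n" if "k < n" for k
      proof -
        have "{j. j < n \<and> k \<in> F' j} = {j. j < n \<and> k \<in> F j}"
          by (auto simp: F'_def)
        then show ?thesis
          using asm that by simp
      qed
    qed (use asm \<alpha> in auto)
    then have "\<bar>real (card (rank_matrices_with_zeros K n r F)) / N - pmf (Q_infty q) (n - r)\<bar>
        \<le> (2 / \<alpha> + 4) * (1 / real q) powr (4 * \<alpha> * real n)"
      using asm unfolding same N_def by simp
    then show "\<exists>E::real.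
            real (card (rank_matrices_with_zeros K n r F)) =
              real q ^ (n\<^sup>2 - (\<Sum>i<n. card (F i))) * (pmf (Q_infty q) (n - r) + E) \<and>
            \<bar>E\<bar> \<le> (2 / \<alpha> + 4) * (1 / real q) powr (4 * \<alpha> * real n)"
      using \<open>N > 0\<close> unfolding N_def[symmetric]
      by (intro exI[of _ "real (card (rank_matrices_with_zeros K n r F)) / N - pmf (Q_infty q) (n - r)"])
        simp
  qed (use \<alpha> in auto)
qed simp

end
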